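(* Let $k$ be an even positive integer and $n$ a positive multiple of $k$. Let $f(y_1,\ldots,y_k)$ be a homogeneous polynomial of degree $\frac{k}{2}(n-1)$ in $k$ variables with coefficients in a commutative ring, which is skew-symmetric, i.e. $f(y_{\sigma(1)},\ldots,y_{\sigma(k)})=(-1)^{\sigma}f(y_1,\ldots,y_k)$ for all $\sigma\in\mathfrak S_k$. Write $f=\sum_{\vec r} a_{\vec r}\, y^{\vec r}$, the sum over weak compositions $\vec r=(r_1,\ldots,r_k)$ of $\frac{k}{2}(n-1)$ into $k$ parts, where $y^{\vec r}=y_1^{r_1}\cdots y_k^{r_k}$. Let $x_1,\ldots,x_n$ be indeterminates, and for a $k$-subset $S=\{s_1<\cdots<s_k\}$ of $[n]$ put $f(x_S)=f(x_{s_1},\ldots,x_{s_k})$. Then $$\operatorname{Pf}\big(f(x_S)\big)_{S\in\binom{[n]}{k}}=\left(\sum_{\beta\in R_{n,k}}(-1)^{\beta}\prod_{i=1}^{n/k}a_{\vec r_i}\right)\cdot\prod_{1\le i<j\le n}(x_j-x_i),$$ where $\beta=\{\vec r_1,\ldots,\vec r_{n/k}\}$ ranges over $R_{n,k}$.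
   Context: Hyperpfaffian: for $k$ even, $n$ a multiple of $k$, and $F$ a function on $k$-element subsets of $[n]=\{1,\ldots,n\}$, $\operatorname{Pf}(F)=\sum_{\tau}(-1)^{\tau}\prod_{i=1}^{n/k}F(B_i)$, the sum over all set partitions $\tau=\{B_1,\ldots,B_{n/k}\}$ of $[n]$ into blocks of size $k$; writing $B_i=\{b_{i,1}<\cdots<b_{i,k}\}$, the sign $(-1)^\tau$ is the sign of the permutation (in one-line notation) $b_{1,1},\ldots,b_{1,k},b_{2,1},\ldots,b_{2,k},\ldots,b_{n/k,1},\ldots,b_{n/k,k}$ (independent of block order since $k$ is even). $\Gamma_{n,k}$ is the set of integer vectors $(r_1,\ldots,r_k)$ with $0\le r_1<r_2<\cdots<r_k$ and $\sum r_i=\frac{k}{2}(n-1)$. $R_{n,k}$ is the set of sets $\beta=\{\vec r_1,\ldots,\vec r_{n/k}\}$ of $n/k$ elements of $\Gamma_{n,k}$ such that all $n$ entries of these vectors are pairwise distinct (hence they are exactly $0,1,\ldots,n-1$). Writing $\vec r_i=(r_{i,1},\ldots,r_{i,k})$, the sign $(-1)^\beta$ is the sign of the permutation $r_{1,1},\ldots,r_{1,k},r_{2,1},\ldots,r_{2,k},\ldots,r_{n/k,1},\ldots,r_{n/k,k}$ of $\{0,1,\ldots,n-1\}$.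
   Formalization: Added assumption: k=2, or 2 is not a zero divisor in the coefficient ring, or f vanishes when two variables are set equal. Without it the claim fails: n=k=4 over Z/2 with f=y_1^6+y_2^6+y_3^6+y_4^6. *)

theory Defs
  imports
    "HOL-Library.Poly_Mapping"
    "HOL-Library.Disjoint_Sets"
    "HOL-Combinatorics.Permutations"
begin

section \<open>Multivariate polynomials\<close>

text \<open>
  A polynomial is a finitely supported map from exponent vectors to coefficients; the
  multiplication of \<^typ>\<open>('b::monoid_add) \<Rightarrow>\<^sub>0 'c::semiring_0\<close> is the convolution product.
  The indeterminates are indexed by all natural numbers; those in use are
  \<open>y\<^sub>1, \<dots>, y\<^sub>k\<close>, respectively \<open>x\<^sub>1, \<dots>, x\<^sub>n\<close>.
\<close>

type_synonym 'a mpoly = "(nat \<Rightarrow>\<^sub>0 nat) \<Rightarrow>\<^sub>0 'a"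

definition Const :: "'a \<Rightarrow> 'a::comm_ring_1 mpoly" where
  "Const c = Poly_Mapping.single 0 c"

definition Var :: "nat \<Rightarrow> 'a::comm_ring_1 mpoly" where
  "Var i = Poly_Mapping.single (Poly_Mapping.single i 1) 1"

definition subst :: "(nat \<Rightarrow> 'a mpoly) \<Rightarrow> 'a mpoly \<Rightarrow> 'a::comm_ring_1 mpoly" where
  "subst g f = (\<Sum>m\<in>Poly_Mapping.keys f.
     Const (Poly_Mapping.lookup f m) * (\<Prod>i\<in>Poly_Mapping.keys m. g i ^ Poly_Mapping.lookup m i))"

definition in_variables :: "nat set \<Rightarrow> 'a::comm_ring_1 mpoly \<Rightarrow> bool" where
  "in_variables V f \<longleftrightarrow> (\<forall>m\<in>Poly_Mapping.keys f. Poly_Mapping.keys m \<subseteq> V)"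

definition homogeneous :: "nat \<Rightarrow> 'a::comm_ring_1 mpoly \<Rightarrow> bool" where
  "homogeneous d f \<longleftrightarrow>
     (\<forall>m\<in>Poly_Mapping.keys f. (\<Sum>i\<in>Poly_Mapping.keys m. Poly_Mapping.lookup m i) = d)"

definition skew_symmetric :: "nat \<Rightarrow> 'a::comm_ring_1 mpoly \<Rightarrow> bool" where
  "skew_symmetric k f \<longleftrightarrow>
     (\<forall>\<sigma>. \<sigma> permutes {1..k} \<longrightarrow> subst (\<lambda>i. Var (\<sigma> i)) f = of_int (sign \<sigma>) * f)"

text \<open>
  \<open>f\<close> becomes \<open>0\<close> when \<open>y\<^sub>i\<close> is set equal to \<open>y\<^sub>j\<close>. A skew-symmetric \<open>f\<close> has this property if
  \<open>2\<close> is not a zero divisor among the coefficients, but not in general.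
\<close>

definition vanishes_on_diagonals :: "nat \<Rightarrow> 'a::comm_ring_1 mpoly \<Rightarrow> bool" where
  "vanishes_on_diagonals k f \<longleftrightarrow>
     (\<forall>i\<in>{1..k}. \<forall>j\<in>{1..k}. i \<noteq> j \<longrightarrow> subst (Var(i := Var j)) f = 0)"

text \<open>The coefficient of \<open>y\<^sub>1\<^bsup>r\<^sub>1\<^esup> \<cdots> y\<^sub>k\<^bsup>r\<^sub>k\<^esup>\<close>; lists are indexed from \<open>0\<close>.\<close>

definition coefficient :: "'a::comm_ring_1 mpoly \<Rightarrow> nat list \<Rightarrow> 'a" where
  "coefficient f r =
     Poly_Mapping.lookup f (\<Sum>i = 1..length r. Poly_Mapping.single i (r ! (i - 1)))"

text \<open>\<open>f(x\<^sub>S) = f(x\<^bsub>s\<^sub>1\<^esub>, \<dots>, x\<^bsub>s\<^sub>k\<^esub>)\<close> for \<open>S = {s\<^sub>1 < \<dots> < s\<^sub>k}\<close>.\<close>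

definition eval_at_subset :: "'a::comm_ring_1 mpoly \<Rightarrow> nat set \<Rightarrow> 'a mpoly" where
  "eval_at_subset f S = subst (\<lambda>i. Var (sorted_list_of_set S ! (i - 1))) f"


section \<open>Signs and the hyperpfaffian\<close>

text \<open>
  The sign of the permutation of \<open>{a..<a + length xs}\<close> whose one-line notation is \<open>xs\<close>;
  \<^const>\<open>sign\<close> expects it to be extended by the identity.
\<close>

definition one_line_sign :: "nat \<Rightarrow> nat list \<Rightarrow> int" where
  "one_line_sign a xs =
     sign (\<lambda>i. if i \<in> {a..<a + length xs} then xs ! (i - a) else i)"

text \<open>
  In the signs of a set partition and of a set of vectors, the blocks, respectively the vectors,
  are listed in an arbitrary order. All of them have the even length \<open>k\<close>, so that the sign does
  not depend on this choice.
\<close>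

definition enumeration :: "'b set \<Rightarrow> 'b list" where
  "enumeration A = (SOME xs. distinct xs \<and> set xs = A)"

definition block_partitions :: "nat \<Rightarrow> nat \<Rightarrow> nat set set set" where
  "block_partitions n k = {\<tau>. partition_on {1..n} \<tau> \<and> (\<forall>B\<in>\<tau>. card B = k)}"

definition partition_sign :: "nat set set \<Rightarrow> int" where
  "partition_sign \<tau> = one_line_sign 1 (concat (map sorted_list_of_set (enumeration \<tau>)))"

definition hyperpfaffian :: "nat \<Rightarrow> nat \<Rightarrow> (nat set \<Rightarrow> 'b) \<Rightarrow> 'b::comm_ring_1" where
  "hyperpfaffian n k F =
     (\<Sum>\<tau>\<in>block_partitions n k. of_int (partition_sign \<tau>) * (\<Prod>B\<in>\<tau>. F B))"


section \<open>The sets \<open>\<Gamma>\<^bsub>n,k\<^esub>\<close> and \<open>R\<^bsub>n,k\<^esub>\<close>\<close>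

definition Gamma_set :: "nat \<Rightarrow> nat \<Rightarrow> nat list set" where
  "Gamma_set n k =
     {r. length r = k \<and> sorted_wrt (<) r \<and> sum_list r = k div 2 * (n - 1)}"

definition R_set :: "nat \<Rightarrow> nat \<Rightarrow> nat list set set" where
  "R_set n k =
     {\<beta>. \<beta> \<subseteq> Gamma_set n k \<and> card \<beta> = n div k \<and> inj_on (\<lambda>(r, i). r ! i) (\<beta> \<times> {..<k})}"

definition vectors_sign :: "nat list set \<Rightarrow> int" where
  "vectors_sign \<beta> = one_line_sign 0 (concat (enumeration \<beta>))"

end

(*
  Expanding every f(x_S), the coefficient of x^e in the hyperpfaffian is the sum over all block
  partitions tau of the sign of tau times the product of the coefficients a_(e|B) over the blocks B.
  If e(i) = e(j) for some i \<noteq> j, exchanging i and j is a sign-reversing involution on the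
  partitions separating i and j, while the others contribute 0. If e is injective, a nonzero summand
  forces the values of e to have sum n(n-1)/2, so e is a bijection onto {0,...,n-1}; then
  tau \<mapsto> {e(B)} identifies the partitions that contribute with R_(n,k), and the coefficient is
  the sign of e times the constant of the theorem. The monomials with these signs add up to the
  Vandermonde product.
*)

theory Submission
  imports Defs "Jordan_Normal_Form.Determinant"
begin

section \<open>The sign of a list\<close>

text \<open>The main obstacle is a repeated exponent inside a block. There skew-symmetry only says
  that a coefficient equals its own negative, which does not make it 0 in the presence of 2-torsion.
  Its vanishing is therefore a separate assumption of the combinatorial part. For polynomials it
  comes from the parity of the degree if \<open>k = 2\<close>, from cancelling 2 if 2 is not a zero
  divisor, or from vanishing on diagonals. The second difficulty is that the sign of a partition is
  defined by an arbitrary enumeration of sorted blocks, whereas the image of a block under a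
  transposition or under \<open>e\<close> need not be sorted when listed entry by entry. The sign is
  therefore rewritten as a product of comparisons over pairs of positions. This makes sense for
  every list and factors over concatenations; sign times coefficients then agrees for all listings
  of a partition. Coefficients of monomials are never compared: the sums are expanded over exponent
  functions, which gives an identity for arbitrary elements of a commutative ring.\<close>

definition order_sign :: "'a::linorder \<Rightarrow> 'a \<Rightarrow> int" where
  "order_sign x y = (if x < y then 1 else if y < x then -1 else 0)"

lemma order_sign_commute: "order_sign y x = - order_sign x y"
  by (auto simp: order_sign_def)

text \<open>The part of the sign that comes from pairs with one entry in each list. Splitting it off
  is what makes the sign factor over concatenations in \<open>list_sign_append\<close>.\<close>

definition cross_sign :: "'a::linorder list \<Rightarrow> 'a list \<Rightarrow> int" where
  "cross_sign xs ys = (\<Prod>x\<leftarrow>xs. \<Prod>y\<leftarrow>ys. order_sign x y)"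

text \<open>For distinct entries this is -1 to the number of inversions. A repeated entry gives 0,
  so the exchange rule below holds for all lists.\<close>

primrec list_sign :: "'a::linorder list \<Rightarrow> int" where
  "list_sign [] = 1"
| "list_sign (x # xs) = cross_sign [x] xs * list_sign xs"

lemma cross_sign_Nil [simp]: "cross_sign [] ys = 1" "cross_sign xs [] = 1"
  by (simp_all add: cross_sign_def map_replicate_const)

lemma cross_sign_append_left: "cross_sign (xs @ xs') ys = cross_sign xs ys * cross_sign xs' ys"
  by (simp add: cross_sign_def)

lemma cross_sign_append_right: "cross_sign xs (ys @ ys') = cross_sign xs ys * cross_sign xs ys'"
  by (induction xs) (simp_all add: cross_sign_def algebra_simps)

lemma cross_sign_Cons_left: "cross_sign (x # xs) ys = cross_sign [x] ys * cross_sign xs ys"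
  using cross_sign_append_left[of "[x]" xs ys] by simp

lemma cross_sign_Cons_right: "cross_sign xs (y # ys) = cross_sign xs [y] * cross_sign xs ys"
  using cross_sign_append_right[of xs "[y]" ys] by simp

lemma cross_sign_singletons: "cross_sign [x] [y] = order_sign x y"
  by (simp add: cross_sign_def)

text \<open>Each comparison between the two lists is reversed once. A list of even length can thus
  be moved past any other without changing the sign.\<close>

lemma cross_sign_commute: "cross_sign ys xs = (-1) ^ (length xs * length ys) * cross_sign xs ys"
proof -
  have single: "cross_sign ys [x] = (-1) ^ length ys * cross_sign [x] ys" for x
  proof (induction ys)
    case (Cons y ys)
    then show ?case
      using cross_sign_Cons_left[of y ys "[x]"] cross_sign_Cons_right[of "[x]" y ys]
      by (simp add: cross_sign_singletons order_sign_commute[of y x])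
  qed simp
  show ?thesis
  proof (induction xs)
    case (Cons x xs)
    then show ?case
      using cross_sign_Cons_left[of x xs ys] cross_sign_Cons_right[of ys x xs]
      by (simp add: single power_add)
  qed simp
qed

text \<open>Reordering a block only permutes the factors that compare it with other blocks, so any
  change of sign happens inside the block.\<close>

lemma cross_sign_mset_cong:
  assumes "mset xs = mset xs'" "mset ys = mset ys'"
  shows "cross_sign xs ys = cross_sign xs' ys'"
proof -
  have "mset (map g zs) = mset (map g zs')" if "mset zs = mset zs'" for g :: "'a \<Rightarrow> int" and zs zs'
    using that by simp
  then have prod_cong: "prod_list (map g zs) = prod_list (map g zs')" if "mset zs = mset zs'"
    for g :: "'a \<Rightarrow> int" and zs zs'
    using that by (metis prod_mset_prod_list)
  have "cross_sign xs ys = (\<Prod>x\<leftarrow>xs. \<Prod>y\<leftarrow>ys'. order_sign x y)"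
    unfolding cross_sign_def by (simp only: prod_cong[OF assms(2)])
  also have "\<dots> = cross_sign xs' ys'"
    unfolding cross_sign_def by (rule prod_cong[OF assms(1)])
  finally show ?thesis .
qed

lemma list_sign_append: "list_sign (xs @ ys) = list_sign xs * list_sign ys * cross_sign xs ys"
proof (induction xs)
  case (Cons x xs)
  then show ?case
    using cross_sign_Cons_left[of x xs ys] by (simp add: cross_sign_append_right)
qed simp

lemma list_sign_sorted: "sorted_wrt (<) xs \<Longrightarrow> list_sign xs = 1"
proof (induction xs)
  case (Cons x xs)
  have "(\<Prod>y\<leftarrow>xs. order_sign x y) = (\<Prod>y\<leftarrow>xs. 1)"
    using Cons.prems by (intro arg_cong[of _ _ prod_list] map_cong) (auto simp: order_sign_def)
  with Cons show ?case
    by (simp add: cross_sign_def map_replicate_const)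
qed simp

lemma list_sign_square: "distinct xs \<Longrightarrow> list_sign xs * list_sign xs = 1"
proof (induction xs)
  case (Cons x xs)
  have square: "(\<Prod>y\<leftarrow>xs. order_sign x y) * (\<Prod>y\<leftarrow>xs. order_sign x y) = 1" if "x \<notin> set xs" for x
    using that
  proof (induction xs)
    case (Cons y ys)
    have "order_sign x y * order_sign x y = 1"
      using Cons.prems by (auto simp: order_sign_def)
    with Cons show ?case
      by (simp add: algebra_simps)
  qed simp
  have "list_sign (x # xs) * list_sign (x # xs) =
      (cross_sign [x] xs * cross_sign [x] xs) * (list_sign xs * list_sign xs)"
    by simp
  also have "cross_sign [x] xs * cross_sign [x] xs = 1"
    using square[of x] Cons.prems by (simp add: cross_sign_def)
  also have "list_sign xs * list_sign xs = 1"
    using Cons by simp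
  finally show ?case
    by simp
qed simp

text \<open>A notion shared by \<open>list_sign\<close> and the coefficients of a skew-symmetric
  polynomial. The length is fixed because skew-symmetry in \<open>k\<close> variables concerns
  exponent lists of length \<open>k\<close>.\<close>

definition skew_on_lists :: "nat \<Rightarrow> ('b list \<Rightarrow> 'r::comm_ring_1) \<Rightarrow> bool" where
  "skew_on_lists k h \<longleftrightarrow>
     (\<forall>A x B y C. length (A @ x # B @ y # C) = k \<longrightarrow> h (A @ x # B @ y # C) = - h (A @ y # B @ x # C))"

text \<open>Only the mutual comparison of the two entries changes. The list \<open>B\<close> has one
  of them before it and one after it; turning the latter comparison round costs
  \<open>(-1) ^ length B\<close> whichever entry stands there, and the remaining product is
  symmetric in both.\<close>

lemma skew_on_lists_list_sign: "skew_on_lists k list_sign"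
  unfolding skew_on_lists_def
proof (intro allI impI)
  fix A B C :: "'a list" and x y
  have "cross_sign B [x] = (-1) ^ length B * cross_sign [x] B"
       "cross_sign B [y] = (-1) ^ length B * cross_sign [y] B"
    by (simp_all add: cross_sign_commute[of B])
  moreover have "list_sign (A @ u # B @ v # C) =
      list_sign A * list_sign B * list_sign C * cross_sign A [u] * cross_sign A B * cross_sign A [v]
      * cross_sign A C * cross_sign [u] B * cross_sign [u] [v] * cross_sign [u] C
      * cross_sign B [v] * cross_sign B C * cross_sign [v] C" for u v
    using list_sign_append[of A "u # B @ v # C"] list_sign_append[of B "v # C"]
      cross_sign_Cons_right[of A u "B @ v # C"] cross_sign_Cons_right[of A v C]
      cross_sign_Cons_right[of B v C] cross_sign_Cons_right[of "[u]" v C]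
    by (simp only: cross_sign_append_right list_sign.simps mult_ac)
  ultimately show "list_sign (A @ x # B @ y # C) = - list_sign (A @ y # B @ x # C)"
    by (simp add: cross_sign_singletons order_sign_commute[of x y])
qed

lemma skew_on_lists_map_permutes:
  assumes h: "skew_on_lists k h" and p: "p permutes {m..<m + k}"
  shows "h (map (g \<circ> p) [m..<m + k]) = of_int (sign p) * h (map g [m..<m + k])"
proof -
  have transpose_step: "h (map (g \<circ> Transposition.transpose i j) [m..<m + k]) = - h (map g [m..<m + k])"
    if "m \<le> i" "i < j" "j < m + k" for g i j
  proof -
    let ?A = "[m..<i]" and ?B = "[Suc i..<j]" and ?C = "[Suc j..<m + k]"
    have split: "[m..<m + k] = ?A @ i # ?B @ j # ?C"
      using that upt_add_eq_append[of m i "m + k - i"] upt_add_eq_append[of "Suc i" j "m + k - j"]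
      by (simp add: upt_conv_Cons)
    have len: "length (map g ?A @ g j # map g ?B @ g i # map g ?C) = k"
      using that by simp
    have "map (g \<circ> Transposition.transpose i j) [m..<m + k] =
        map g ?A @ g j # map g ?B @ g i # map g ?C"
      unfolding split using that by (auto simp: transpose_def)
    moreover have "map g [m..<m + k] = map g ?A @ g i # map g ?B @ g j # map g ?C"
      unfolding split by simp
    ultimately show ?thesis
      using h len unfolding skew_on_lists_def by metis
  qed
  \<comment> \<open>The induction composes \<open>p\<close> with transpositions on the right, where
    they act on positions, so each of them exchanges two entries of the list.\<close>
  from finite_atLeastLessThan p show ?thesis
  proof (induction rule: permutes_rev_induct)
    case id
    then show ?case by simp
  next
    case (swap i j p)
    have "permutation p" "permutation (Transposition.transpose i j)"
      using swap.hyps by (auto intro: permutation_permutes[THEN iffD2] permutation_swap_id)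
    then have sign_step: "sign (p \<circ> Transposition.transpose i j) = - sign p"
      using swap.hyps by (simp add: sign_compose sign_swap_id)
    have "h (map (g \<circ> p \<circ> Transposition.transpose i j) [m..<m + k]) = - h (map (g \<circ> p) [m..<m + k])"
    proof (cases "i < j")
      case True
      then show ?thesis using swap.hyps transpose_step[of i j "g \<circ> p"] by auto
    next
      case False
      then show ?thesis using swap.hyps transpose_step[of j i "g \<circ> p"]
        by (auto simp: transpose_commute[of i j])
    qed
    also have "\<dots> = of_int (sign (p \<circ> Transposition.transpose i j)) * h (map g [m..<m + k])"
      by (simp only: swap.IH sign_step of_int_minus mult_minus_left)
    finally show ?case
      by (simp only: o_assoc)
  qed
qed

lemma skew_on_lists_permute_list:
  assumes "skew_on_lists (length xs) h" "p permutes {..<length xs}"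
  shows "h (permute_list p xs) = of_int (sign p) * h xs"
proof -
  have "h (map ((!) xs \<circ> p) [0..<0 + length xs]) = of_int (sign p) * h (map ((!) xs) [0..<0 + length xs])"
    using assms by (intro skew_on_lists_map_permutes) (auto simp: lessThan_atLeast0)
  then show ?thesis
    by (simp add: permute_list_def comp_def map_nth)
qed

section \<open>Permutations in one-line notation\<close>

lemma list_as_permutation:
  assumes "distinct xs" "set xs = {m..<m + length xs}"
  obtains p where "p permutes {m..<m + length xs}" "map p [m..<m + length xs] = xs"
    "one_line_sign m xs = sign p"
proof
  let ?p = "\<lambda>i. if i \<in> {m..<m + length xs} then xs ! (i - m) else i"
  show map: "map ?p [m..<m + length xs] = xs"
    by (rule nth_equalityI) auto
  have "?p ` {m..<m + length xs} = {m..<m + length xs}"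
    using arg_cong[OF map, of set] assms(2) by simp
  moreover have "inj_on ?p {m..<m + length xs}"
    using assms(1) arg_cong[OF map, of distinct] by (simp only: distinct_map set_upt simp_thms)
  ultimately have "bij_betw ?p {m..<m + length xs} {m..<m + length xs}"
    by (simp only: bij_betw_def)
  then show "?p permutes {m..<m + length xs}"
    by (rule bij_imp_permutes) (simp only: if_False)
qed (simp add: one_line_sign_def)

text \<open>The list arises from the increasing one, which has sign 1, by the permutation that it
  denotes, and the exchange rule returns the sign of that permutation.\<close>

lemma one_line_sign_eq_list_sign:
  assumes "distinct xs" "set xs = {m..<m + length xs}"
  shows "one_line_sign m xs = list_sign xs"
proof -
  obtain p where p: "p permutes {m..<m + length xs}" "map p [m..<m + length xs] = xs"
    "one_line_sign m xs = sign p"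
    using list_as_permutation[OF assms] .
  from skew_on_lists_map_permutes[OF skew_on_lists_list_sign p(1), of "\<lambda>i. i"]
  show ?thesis
    by (simp add: p comp_def list_sign_sorted)
qed

text \<open>Multiplicativity of the sign. It is applied to a transposition of two points and to an
  exponent function \<open>e\<close>.\<close>

lemma list_sign_map:
  assumes "distinct xs" "set xs = {m..<m + length xs}"
  shows "list_sign (map g xs) = list_sign xs * list_sign (map g [m..<m + length xs])"
proof -
  obtain p where p: "p permutes {m..<m + length xs}" "map p [m..<m + length xs] = xs"
    "one_line_sign m xs = sign p"
    using list_as_permutation[OF assms] .
  have "map (g \<circ> p) [m..<m + length xs] = map g xs"
    using p(2) by (metis map_map)
  with skew_on_lists_map_permutes[OF skew_on_lists_list_sign p(1), of g]
  show ?thesis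
    by (simp add: p flip: one_line_sign_eq_list_sign[OF assms])
qed

section \<open>The Vandermonde product\<close>

text \<open>Column operations: passing from the powers to the monic polynomials \<open>P j\<close>
  with roots \<open>x i\<close>, \<open>i < j\<close>, is multiplication by the unitriangular matrix
  \<open>U\<close>. The result \<open>L\<close> is lower triangular, since \<open>P j\<close>
  vanishes at all \<open>x i\<close> with \<open>i < j\<close>.\<close>

lemma vandermonde_det:
  fixes x :: "nat \<Rightarrow> 'r::comm_ring_1"
  shows "det (mat n n (\<lambda>(i, j). x i ^ j)) = (\<Prod>j<n. \<Prod>i<j. x j - x i)"
proof -
  define P where "P j = (\<Prod>i<j. [:- x i, 1:])" for j
  define U where "U = mat n n (\<lambda>(l, j). coeff (P j) l)"
  define V where "V = mat n n (\<lambda>(i, j). x i ^ j)"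
  define L where "L = mat n n (\<lambda>(i, j). poly (P j) (x i))"
  have P_Suc: "P (Suc j) = P j * [:- x j, 1:]" for j
    by (simp add: P_def)
  have P_coeff: "degree (P j) \<le> j \<and> coeff (P j) j = 1" for j
  proof (induction j)
    case (Suc j)
    have "degree (P (Suc j)) \<le> Suc j"
      unfolding P_Suc using Suc degree_mult_le[of "P j" "[:- x j, 1:]"] by auto
    then show ?case
      using Suc by (simp add: P_Suc coeff_eq_0)
  qed (simp add: P_def)
  have carrier: "U \<in> carrier_mat n n" "V \<in> carrier_mat n n" "L \<in> carrier_mat n n"
    by (simp_all add: U_def V_def L_def)
  have "V * U = L"
  proof (rule eq_matI)
    fix i j assume ij: "i < dim_row L" "j < dim_col L"
    have "poly (P j) (x i) = (\<Sum>l\<le>n - 1. coeff (P j) l * x i ^ l)"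
      using P_coeff[of j] ij
      unfolding poly_altdef by (intro sum.mono_neutral_left) (auto simp: L_def coeff_eq_0)
    also have "{..n - 1} = {0..<n}"
      using ij by (auto simp: L_def)
    finally show "(V * U) $$ (i, j) = L $$ (i, j)"
      using ij by (simp add: L_def V_def U_def scalar_prod_def mult.commute)
  qed (simp_all add: V_def U_def L_def)
  moreover have "det U = 1"
  proof -
    have "upper_triangular U"
      unfolding upper_triangular_def
      using P_coeff by (auto simp: U_def intro!: coeff_eq_0 intro: le_less_trans)
    then have "det U = prod_list (diag_mat U)"
      using carrier(1) by (rule det_upper_triangular)
    also have "diag_mat U = map (\<lambda>_. 1) [0..<n]"
      using P_coeff by (auto simp: diag_mat_def U_def)
    finally show ?thesis
      by (simp add: map_replicate_const)
  qed
  moreover have "det L = (\<Prod>j<n. \<Prod>i<j. x j - x i)"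
  proof -
    have "det L = prod_list (diag_mat L)"
      by (rule det_lower_triangular[OF _ carrier(3)])
         (auto simp: L_def P_def poly_prod intro!: prod_zero)
    also have "diag_mat L = map (\<lambda>j. \<Prod>i<j. x j - x i) [0..<n]"
      by (auto simp: diag_mat_def L_def P_def poly_prod)
    also have "prod_list \<dots> = (\<Prod>j<n. \<Prod>i<j. x j - x i)"
      by (subst prod.distinct_set_conv_list[symmetric]) (simp_all add: lessThan_atLeast0)
    finally show ?thesis .
  qed
  ultimately show ?thesis
    using det_mult[OF carrier(2,1)] by (simp add: V_def)
qed

text \<open>The Leibniz formula, indexed by exponent functions on \<open>{1..n}\<close> instead of
  permutations of \<open>{0..<n}\<close>. Extensionality makes each function a unique
  representative, as in the expansion over \<open>\<rightarrow>\<^sub>E\<close> in which these terms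
  reappear.\<close>

lemma vandermonde_bijections:
  fixes x :: "nat \<Rightarrow> 'r::comm_ring_1"
  shows "(\<Prod>j\<in>{1..n}. \<Prod>i\<in>{1..<j}. x j - x i) =
    (\<Sum>e | e \<in> extensional {1..n} \<and> bij_betw e {1..n} {..<n}.
       of_int (list_sign (map e [1..<1 + n])) * (\<Prod>i\<in>{1..n}. x i ^ e i))"
proof -
  let ?P = "{p. p permutes {0..<n}}"
  let ?E = "{e. e \<in> extensional {1..n} \<and> bij_betw e {1..n} {..<n}}"
  define E where "E p = restrict (\<lambda>i. p (i - 1)) {1..n}" for p :: "nat \<Rightarrow> nat"
  define Q where "Q e i = (if i < n then e (Suc i) else i)" for e :: "nat \<Rightarrow> nat" and i
  have shift: "{1..n} = Suc ` {0..<n}"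
    by (simp add: image_Suc_atLeastLessThan atLeastLessThanSuc_atLeastAtMost)
  have "(\<Prod>j\<in>{1..n}. \<Prod>i\<in>{1..<j}. x j - x i) = (\<Prod>j<n. \<Prod>i\<in>{1..<Suc j}. x (Suc j) - x i)"
    unfolding shift prod.reindex[OF inj_Suc] comp_def lessThan_atLeast0 ..
  also have "\<dots> = (\<Prod>j<n. \<Prod>i<j. x (Suc j) - x (Suc i))"
    unfolding One_nat_def image_Suc_atLeastLessThan[symmetric] prod.reindex[OF inj_Suc]
      comp_def lessThan_atLeast0 ..
  also have "\<dots> = det (mat n n (\<lambda>(i, j). x (Suc i) ^ j))"
    by (simp add: vandermonde_det[of n "\<lambda>i. x (Suc i)"])
  also have "\<dots> = (\<Sum>p\<in>?P. of_int (sign p) * (\<Prod>i = 0..<n. x (Suc i) ^ p i))"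
    by (subst det_def'[of _ n])
       (auto intro!: sum.cong prod.cong arg_cong2[of _ _ _ _ "(*)"] simp: sign_def)
  also have "\<dots> = (\<Sum>e\<in>?E. of_int (list_sign (map e [1..<1 + n])) * (\<Prod>i\<in>{1..n}. x i ^ e i))"
  proof (rule sum.reindex_bij_witness[of _ Q E])
    fix p assume p: "p \<in> ?P"
    have image: "p ` {0..<n} = {0..<n}"
      using p permutes_image by auto
    show "Q (E p) = p"
      using p by (auto simp: Q_def E_def fun_eq_iff permutes_def)
    have "E p ` {1..n} = (\<lambda>i. p (i - 1)) ` {1..n}"
      by (simp add: E_def)
    then have image_E: "E p ` {1..n} = {..<n}"
      unfolding shift image_image using image by (simp add: lessThan_atLeast0)
    moreover have "inj_on (E p) {1..n}"
      by (rule eq_card_imp_inj_on) (simp_all add: image_E[unfolded One_nat_def])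
    ultimately show "E p \<in> ?E"
      by (simp add: bij_betw_def E_def)
    have "map (E p) [1..<1 + n] = map p [0..<n]"
      by (rule nth_equalityI) (auto simp: E_def simp del: upt_Suc)
    also have "list_sign \<dots> = sign p"
      using skew_on_lists_map_permutes[OF skew_on_lists_list_sign[of n], of p 0 "\<lambda>i. i"] p
      by (simp add: comp_def list_sign_sorted)
    finally have "list_sign (map (E p) [1..<1 + n]) = sign p" .
    moreover have "(\<Prod>i\<in>{1..n}. x i ^ E p i) = (\<Prod>i = 0..<n. x (Suc i) ^ p i)"
      unfolding shift prod.reindex[OF inj_Suc] by (intro prod.cong) (auto simp: E_def)
    ultimately show "of_int (list_sign (map (E p) [1..<1 + n])) * (\<Prod>i\<in>{1..n}. x i ^ E p i) =
        of_int (sign p) * (\<Prod>i = 0..<n. x (Suc i) ^ p i)"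
      by (simp only:)
  next
    fix e assume e: "e \<in> ?E"
    then show "E (Q e) = e"
      by (auto simp: Q_def E_def fun_eq_iff extensional_def)
    have "bij_betw (e \<circ> Suc) {0..<n} {..<n}"
      using e unfolding shift by (intro bij_betw_trans[of Suc _ "Suc ` {0..<n}"]) (auto simp: bij_betw_def)
    then have "bij_betw (Q e) {0..<n} {0..<n}"
      by (subst bij_betw_cong[of _ _ "e \<circ> Suc"]) (auto simp: Q_def lessThan_atLeast0)
    then have "Q e permutes {0..<n}"
      by (rule bij_imp_permutes) (simp add: Q_def)
    then show "Q e \<in> ?P"
      by simp
  qed
  finally show ?thesis .
qed

section \<open>Weights of block partitions\<close>

lemma enumeration:
  assumes "finite A"
  shows "distinct (enumeration A)" "set (enumeration A) = A"
  using someI_ex[OF finite_distinct_list[OF assms], unfolded conj_commute[of "set _ = A"]]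
  by (simp_all add: enumeration_def)

lemma prod_list_enumeration:
  assumes "finite A"
  shows "(\<Prod>x\<leftarrow>enumeration A. h x) = (\<Prod>x\<in>A. h x)"
  using prod.distinct_set_conv_list[OF enumeration(1)[OF assms], of h]
  by (simp add: enumeration(2)[OF assms])

lemma list_sign_move_front:
  assumes "even (length ys)"
  shows "list_sign (xs @ ys @ zs) = list_sign (ys @ xs @ zs)"
  using assms by (simp add: list_sign_append cross_sign_append_right cross_sign_commute[of xs ys])

text \<open>A multiset of multisets forgets the order of the blocks and the order inside them. Empty
  lists are excluded because distinctness of the concatenation does not prevent them from occurring
  several times.\<close>

lemma mset_map_mset_eq:
  assumes "distinct (concat ls)" "[] \<notin> set ls"
  shows "mset (map mset ls) = image_mset mset_set (mset_set (set ` set ls))"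
proof -
  have dist: "distinct ls" "\<forall>l\<in>set ls. distinct l"
    "\<And>l l'. l \<in> set ls \<Longrightarrow> l' \<in> set ls \<Longrightarrow> l \<noteq> l' \<Longrightarrow> set l \<inter> set l' = {}"
    using assms by (auto simp: distinct_concat_iff)
  have "inj_on set (set ls)"
    by (rule inj_onI) (metis dist(3) assms(2) inf.idem set_empty)
  then have "mset (map set ls) = mset_set (set ` set ls)"
    using dist(1) by (metis distinct_map mset_set_set set_map)
  moreover have "map mset ls = map mset_set (map set ls)"
    using dist(2) by (simp add: mset_set_set)
  ultimately show ?thesis
    by (simp only: mset_map)
qed

text \<open>Polynomials are left out: \<open>a\<close> takes values in any commutative ring and is
  later the coefficient function embedded into the polynomial ring, so that it shares a ring with
  the indeterminates.\<close>

locale alternating_coefficients =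
  fixes n k :: nat and a :: "nat list \<Rightarrow> 'r::comm_ring_1"
  assumes k: "even k" "k > 0" and n: "k dvd n" "n > 0"
    and skew: "skew_on_lists k a"
    and repeated: "length r = k \<Longrightarrow> \<not> distinct r \<Longrightarrow> a r = 0"
    and degree: "length r = k \<Longrightarrow> sum_list r \<noteq> k div 2 * (n - 1) \<Longrightarrow> a r = 0"
begin

text \<open>Allowing blocks in any order, with entries in any order, means that images of blocks
  under a map can be used as they stand.\<close>

definition listing_weight :: "(nat \<Rightarrow> nat) \<Rightarrow> nat list list \<Rightarrow> 'r" where
  "listing_weight e ls = of_int (list_sign (concat ls)) * (\<Prod>l\<leftarrow>ls. a (map e l))"

definition partition_weight :: "(nat \<Rightarrow> nat) \<Rightarrow> nat set set \<Rightarrow> 'r" where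
  "partition_weight e \<tau> = of_int (partition_sign \<tau>) * (\<Prod>B\<in>\<tau>. a (map e (sorted_list_of_set B)))"

definition block_listing :: "nat list list \<Rightarrow> bool" where
  "block_listing ls \<longleftrightarrow>
     distinct (concat ls) \<and> set (concat ls) = {1..n} \<and> (\<forall>l\<in>set ls. length l = k)"

text \<open>Reordering a block multiplies both factors by the sign of the same permutation, and the
  square of that sign is 1.\<close>

lemma sign_times_coefficient_cong:
  assumes "mset l = mset l'" "length l = k"
  shows "of_int (list_sign l) * a (map e l) = of_int (list_sign l') * a (map e l')"
proof -
  have len: "length l' = k"
    using assms mset_eq_length by metis
  obtain p where p: "p permutes {..<length l'}" "permute_list p l' = l"
    using mset_eq_permutation[OF assms(1)] .
  have sign: "list_sign l = sign p * list_sign l'"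
    using skew_on_lists_permute_list[OF skew_on_lists_list_sign p(1)] p(2) by simp
  have coeff: "a (map e l) = of_int (sign p) * a (map e l')"
    using skew_on_lists_permute_list[of "map e l'" a p] skew p(1) len
    by (simp add: permute_list_map[OF p(1)] p(2))
  have "of_int (list_sign l) * a (map e l) =
      of_int (sign p * sign p) * (of_int (list_sign l') * a (map e l'))"
    unfolding sign coeff of_int_mult by (simp only: mult_ac)
  then show ?thesis
    by (simp add: sign_idempotent)
qed

lemma listing_weight_Cons:
  "listing_weight e (l # ls) =
     of_int (list_sign l) * a (map e l) * of_int (cross_sign l (concat ls)) * listing_weight e ls"
  by (simp add: listing_weight_def list_sign_append mult_ac)

text \<open>Since \<open>k\<close> is even, moving a block past other blocks does not change the sign.\<close>

lemma listing_weight_cong: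
  assumes "mset (map mset ls) = mset (map mset ls')" "\<forall>l\<in>set ls. length l = k"
  shows "listing_weight e ls = listing_weight e ls'"
  using assms
proof (induction ls arbitrary: ls')
  case (Cons l ls)
  have "mset l \<in> set (map mset ls')"
    using Cons.prems(1) by (metis list.set_intros(1) list.simps(9) mset_eq_setD)
  then obtain l' where l': "l' \<in> set ls'" "mset l = mset l'"
    by auto
  then obtain A B where ls': "ls' = A @ l' # B"
    by (meson split_list)
  have rest: "mset (map mset ls) = mset (map mset (A @ B))"
    using Cons.prems(1) l' by (simp add: ls')
  have len: "length l = k" "length l' = k"
    using Cons.prems(2) l'(2) mset_eq_length[OF l'(2)] by auto
  have "mset (concat ls) = mset (concat (A @ B))"
    using rest by (metis mset_concat sum_mset_sum_list)
  then have cross: "cross_sign l (concat ls) = cross_sign l' (concat (A @ B))"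
    using l'(2) by (intro cross_sign_mset_cong)
  have "listing_weight e ls' = listing_weight e (l' # A @ B)"
    using list_sign_move_front[of l' "concat A" "concat B"] len k(1)
    by (simp add: listing_weight_def ls' mult_ac)
  also have "\<dots> = listing_weight e (l # ls)"
    using Cons.IH[OF rest] Cons.prems(2) sign_times_coefficient_cong[OF l'(2) len(1), of e] cross
    by (simp add: listing_weight_Cons)
  finally show ?case ..
qed simp

lemma block_listing_nonempty: "block_listing ls \<Longrightarrow> [] \<notin> set ls"
  using k(2) by (auto simp: block_listing_def)

lemma block_listing_partition:
  assumes "block_listing ls"
  shows "set ` set ls \<in> block_partitions n k"
  using assms block_listing_nonempty[OF assms]
  by (auto simp: block_listing_def block_partitions_def partition_on_def disjoint_def
    distinct_concat_iff distinct_card)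

lemma block_listing_length:
  assumes "block_listing ls"
  shows "k * length ls = n"
proof -
  have "n = length (concat ls)"
    using assms distinct_card[of "concat ls"] by (simp add: block_listing_def)
  also have "\<dots> = k * length ls"
    using assms sum_list_triv[of k ls]
    by (simp add: block_listing_def length_concat cong: map_cong)
  finally show ?thesis ..
qed

text \<open>The definition of the sign of a partition already singles out a listing, with sorted
  blocks in the order of \<open>enumeration\<close>. It is the one to which all other listings are
  compared.\<close>

lemma canonical_listing:
  assumes "\<tau> \<in> block_partitions n k"
  defines "ls \<equiv> map sorted_list_of_set (enumeration \<tau>)"
  shows "block_listing ls" "set ` set ls = \<tau>" "partition_weight e \<tau> = listing_weight e ls"
    "k * card \<tau> = n"
proof -
  have \<tau>: "partition_on {1..n} \<tau>" "\<And>B. B \<in> \<tau> \<Longrightarrow> card B = k"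
    using assms(1) by (auto simp: block_partitions_def)
  have fin: "finite \<tau>" "\<And>B. B \<in> \<tau> \<Longrightarrow> finite B"
    using \<tau>(1) finite_elements by (blast, metis card_gt_0_iff k(2) \<tau>(2))
  note enum = enumeration[OF fin(1)]
  have inj: "inj_on sorted_list_of_set \<tau>"
    by (rule inj_onI) (metis fin(2) set_sorted_list_of_set)
  have disj: "B = B'" if "B \<in> \<tau>" "B' \<in> \<tau>" "x \<in> B" "x \<in> B'" for B B' x
    using that partition_onD2[OF \<tau>(1)] unfolding disjoint_def by blast
  have "distinct (concat ls)"
  proof (rule distinct_concat)
    show "distinct ls"
      using enum inj by (simp add: ls_def distinct_map)
    show "distinct l" if "l \<in> set ls" for l
      using that by (auto simp: ls_def)
    show "set l \<inter> set l' = {}" if "l \<in> set ls" "l' \<in> set ls" "l \<noteq> l'" for l l'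
      using that enum(2) fin(2) disj by (fastforce simp: ls_def)
  qed
  moreover have union: "set (concat ls) = {1..n}"
    using enum fin \<tau>(1) by (auto simp: ls_def partition_on_def)
  ultimately show listing: "block_listing ls"
    using enum(2) \<tau>(2) by (auto simp: block_listing_def ls_def)
  show "set ` set ls = \<tau>"
    using enum(2) fin(2) by (auto simp: ls_def image_image)
  have "length (concat ls) = n"
    using listing distinct_card[of "concat ls"] by (simp add: block_listing_def)
  then have "partition_sign \<tau> = list_sign (concat ls)"
    using listing unfolding partition_sign_def ls_def[symmetric]
    by (intro one_line_sign_eq_list_sign) (auto simp: block_listing_def)
  then show "partition_weight e \<tau> = listing_weight e ls"
    by (simp add: partition_weight_def listing_weight_def ls_def comp_def
      flip: prod_list_enumeration[OF fin(1)])
  show "k * card \<tau> = n"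
    using block_listing_length[OF listing] distinct_card[OF enum(1)] by (simp add: ls_def enum(2))
qed

text \<open>Any listing of the partition agrees with the canonical one as a multiset of multisets.
  This removes the arbitrary choice made by \<open>enumeration\<close>.\<close>

lemma partition_weight_eq_listing_weight:
  assumes "block_listing ls"
  shows "partition_weight e (set ` set ls) = listing_weight e ls"
proof -
  note bp = block_listing_partition[OF assms]
  let ?ls = "map sorted_list_of_set (enumeration (set ` set ls))"
  note canon = canonical_listing[OF bp]
  have "distinct (concat ls)" "distinct (concat ?ls)"
    using assms canon(1) by (simp_all only: block_listing_def)
  then have "mset (map mset ls) = mset (map mset ?ls)"
    by (simp only: mset_map_mset_eq block_listing_nonempty[OF assms]
      block_listing_nonempty[OF canon(1)] canon(2) not_False_eq_True)
  moreover have "\<forall>l\<in>set ls. length l = k"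
    using assms by (simp add: block_listing_def)
  ultimately show ?thesis
    unfolding canon(3) by (rule listing_weight_cong[symmetric])
qed

lemma finite_block_partitions: "finite (block_partitions n k)"
  by (rule finite_subset[OF _ finitely_many_partition_on[of "{1..n}"]])
     (auto simp: block_partitions_def)

section \<open>Exponent functions that are not injective\<close>

lemma listing_weight_transpose:
  assumes "block_listing ls" "i \<in> {1..n}" "j \<in> {1..n}" "i \<noteq> j" "e i = e j"
  defines "w \<equiv> Transposition.transpose i j"
  shows "block_listing (map (map w) ls)"
    "listing_weight e (map (map w) ls) = - listing_weight e ls"
proof -
  have w: "w permutes {1..<1 + n}"
    unfolding w_def using assms by (intro permutes_swap_id) auto
  have interval: "{1..n} = {1..<1 + n}"
    by auto
  have concat: "concat (map (map w) ls) = map w (concat ls)"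
    by (simp add: map_concat)
  have ls: "distinct (concat ls)" "set (concat ls) = {1..<1 + n}"
    using assms(1) by (auto simp: block_listing_def)
  have len: "length (concat ls) = n"
    using distinct_card[OF ls(1)] ls(2) by simp
  show "block_listing (map (map w) ls)"
    using assms(1) permutes_inj[OF w] permutes_image[OF w]
    unfolding block_listing_def concat interval
    by (auto simp: distinct_map simp del: set_concat intro: inj_on_subset)
  have "list_sign (map w (concat ls)) = list_sign (concat ls) * list_sign (map w [1..<1 + n])"
    using list_sign_map[of "concat ls" 1 w] ls len by simp
  also have "list_sign (map w [1..<1 + n]) = sign w"
    using skew_on_lists_map_permutes[OF skew_on_lists_list_sign w, of "\<lambda>i. i"]
    by (simp add: comp_def list_sign_sorted del: upt_Suc)
  also have "sign w = -1"
    using assms by (simp add: w_def sign_swap_id)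
  finally have "list_sign (map w (concat ls)) = - list_sign (concat ls)"
    by simp
  \<comment> \<open>The coefficients do not notice the exchange, as \<open>e\<close> agrees at
    \<open>i\<close> and \<open>j\<close>; only the sign changes.\<close>
  moreover have "e \<circ> w = e"
    using assms by (auto simp: fun_eq_iff transpose_def)
  ultimately show "listing_weight e (map (map w) ls) = - listing_weight e ls"
    by (simp add: listing_weight_def concat comp_def)
qed

lemma sum_partition_weight_not_inj:
  assumes "i \<in> {1..n}" "j \<in> {1..n}" "i \<noteq> j" "e i = e j"
  shows "(\<Sum>\<tau>\<in>block_partitions n k. partition_weight e \<tau>) = 0"
proof -
  define w where "w = Transposition.transpose i j"
  define h where "h \<tau> = (\<lambda>B. w ` B) ` \<tau>" for \<tau> :: "nat set set"
  define X where "X = {\<tau> \<in> block_partitions n k. \<forall>B\<in>\<tau>. \<not> (i \<in> B \<and> j \<in> B)}"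
  \<comment> \<open>A block containing both \<open>i\<close> and \<open>j\<close> has a repeated
    exponent; this is where \<open>repeated\<close> is used.\<close>
  have "partition_weight e \<tau> = 0" if \<tau>: "\<tau> \<in> block_partitions n k" "\<tau> \<notin> X" for \<tau>
  proof -
    from that obtain B where B: "B \<in> \<tau>" "i \<in> B" "j \<in> B"
      by (auto simp: X_def)
    have fin: "finite \<tau>" "card B = k"
      using \<tau>(1) B(1) finite_elements[of "{1..n}" \<tau>] by (auto simp: block_partitions_def)
    have "finite B"
      using fin(2) k(2) by (simp add: card_ge_0_finite)
    have "\<not> inj_on e B"
      using B assms by (meson inj_onD)
    then have "a (map e (sorted_list_of_set B)) = 0"
      using fin \<open>finite B\<close> by (intro repeated) (auto simp: distinct_map)
    then show ?thesis
      using B fin by (metis (mono_tags, lifting) mult_zero_right partition_weight_def prod_zero)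
  qed
  then have "(\<Sum>\<tau>\<in>block_partitions n k. partition_weight e \<tau>) = (\<Sum>\<tau>\<in>X. partition_weight e \<tau>)"
    by (intro sum.mono_neutral_right finite_block_partitions) (auto simp: X_def)
  also have "\<dots> = 0"
  proof (rule sum_involution_eq_0)
    fix \<tau> assume \<tau>: "\<tau> \<in> X"
    let ?ls = "map sorted_list_of_set (enumeration \<tau>)"
    have bp: "\<tau> \<in> block_partitions n k"
      using \<tau> by (simp add: X_def)
    note canon = canonical_listing[OF bp]
    note weight = listing_weight_transpose[where e = e, OF canon(1) assms, folded w_def]
    have h_listing: "h \<tau> = set ` set (map (map w) ?ls)"
      using arg_cong[OF canon(2), of h] by (simp add: h_def image_image)
    show "partition_weight e (h \<tau>) + partition_weight e \<tau> = 0"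
      using partition_weight_eq_listing_weight[OF weight(1)] weight(2) canon(3)
      by (simp only: h_listing) simp
    have "h \<tau> \<in> block_partitions n k"
      using block_listing_partition[OF weight(1)] by (simp only: h_listing)
    moreover have "\<not> (i \<in> B \<and> j \<in> B)" if B: "B \<in> h \<tau>" for B
    proof -
      obtain B' where "B' \<in> \<tau>" "B = w ` B'"
        using B by (auto simp: h_def)
      moreover have "i \<in> w ` B' \<longleftrightarrow> j \<in> B'" "j \<in> w ` B' \<longleftrightarrow> i \<in> B'"
        by (simp_all add: w_def in_transpose_image_iff)
      ultimately show ?thesis
        using \<tau> unfolding X_def by blast
    qed
    ultimately show "h \<tau> \<in> X"
      by (simp add: X_def)
    show "h (h \<tau>) = \<tau>"
      by (simp add: h_def image_image w_def)
    \<comment> \<open>At a fixed point the cancellation would only show that twice the weight is 0.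
      As \<open>k\<close> is even, the block of \<open>i\<close> contains another element, different
      from \<open>j\<close> and hence fixed by \<open>w\<close>. If the partition were fixed, the
      block and its image would share this element and coincide, so \<open>j\<close> would lie in
      the block.\<close>
    show "h \<tau> \<noteq> \<tau>"
    proof
      assume fixed: "h \<tau> = \<tau>"
      have part: "partition_on {1..n} \<tau>" "\<And>B. B \<in> \<tau> \<Longrightarrow> card B = k"
        using bp by (auto simp: block_partitions_def)
      obtain B where B: "B \<in> \<tau>" "i \<in> B"
        using part(1) assms(1) unfolding partition_on_def by blast
      then have "j \<notin> B"
        using \<tau> by (auto simp: X_def)
      have "card B \<noteq> 1"
        using part(2)[OF B(1)] k by auto
      then obtain c where c: "c \<in> B" "c \<noteq> i"
        using B(2) by (metis is_singletonI' is_singleton_altdef empty_iff)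
      then have "w c = c"
        using \<open>j \<notin> B\<close> by (auto simp: w_def transpose_def)
      then have "c \<in> w ` B"
        using c by (metis imageI)
      moreover have "w ` B \<in> \<tau>"
        using fixed B(1) by (auto simp: h_def)
      ultimately have "w ` B = B"
        using part(1) B(1) c(1) unfolding partition_on_def disjoint_def by blast
      then show False
        using B(2) \<open>j \<notin> B\<close> by (metis imageI transpose_apply_first w_def)
    qed
  qed
  finally show ?thesis .
qed

end

section \<open>Sums of distinct natural numbers and products of sums\<close>

lemma initial_segment_if_sum:
  fixes A :: "nat set"
  assumes "finite A" "card A = n" "2 * \<Sum>A = n * (n - 1)"
  shows "A = {..<n}"
proof -
  let ?N = "{..<n}"
  have "\<Sum>?N = n * (n - 1) div 2"
    using gauss_sum_from_Suc_0[of "n - 1"] Sum_Ico_nat[of 0 n] by (simp add: lessThan_atLeast0)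
  then have total: "\<Sum>A = \<Sum>?N"
    using assms(3) by simp
  \<comment> \<open>Excess elements are at least \<open>n\<close>, missing ones are below
    \<open>n\<close>, and there are equally many of both, so equal totals leave room for
    neither.\<close>
  have card: "card (A - ?N) = card (?N - A)"
    using assms(1,2) card_le_sym_Diff[of A ?N] card_le_sym_Diff[of ?N A] by simp
  have "\<Sum>(A - ?N) = \<Sum>(?N - A)"
    using total sum.Int_Diff[of A id ?N] sum.Int_Diff[of ?N id A] assms(1)
    by (simp add: Int_commute)
  moreover have "n * card (A - ?N) \<le> \<Sum>(A - ?N)"
    using sum_bounded_below[of "A - ?N" n id] by (simp add: mult.commute)
  moreover have "\<Sum>(?N - A) < n * card (?N - A)" if "?N - A \<noteq> {}"
    using that sum_strict_mono[of "?N - A" id "\<lambda>_. n"] by (simp add: mult.commute)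
  ultimately have "?N - A = {}"
    using card by (metis leD)
  with assms(1) card show ?thesis
    by auto
qed

lemma sum_list_concat: "sum_list (concat xss) = (\<Sum>xs\<leftarrow>xss. sum_list xs)"
  by (induction xss) simp_all

text \<open>Choosing one function on each of several disjoint blocks amounts to choosing one
  function on their union: restriction and gluing are inverse to each other. The hypothesis
  \<open>local\<close> lets each factor be evaluated at the glued function.\<close>

lemma prod_sum_PiE_Union:
  fixes g :: "'b set \<Rightarrow> ('b \<Rightarrow> 'c) \<Rightarrow> 'r::comm_ring_1"
  assumes "finite T" "disjoint T"
    and local: "\<And>B e e'. B \<in> T \<Longrightarrow> (\<And>i. i \<in> B \<Longrightarrow> e i = e' i) \<Longrightarrow> g B e = g B e'"
  shows "(\<Prod>B\<in>T. \<Sum>e\<in>B \<rightarrow>\<^sub>E X. g B e) = (\<Sum>e\<in>\<Union>T \<rightarrow>\<^sub>E X. \<Prod>B\<in>T. g B e)"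
  using assms
proof (induction T)
  case (insert B T)
  let ?h = "\<lambda>e. \<Prod>B\<in>T. g B e"
  have disj: "B \<inter> \<Union>T = {}"
    using insert.prems(1) insert.hyps(2) by (auto simp: disjoint_def)
  have h_local: "?h e = ?h e'" if "\<And>i. i \<in> \<Union>T \<Longrightarrow> e i = e' i" for e e'
    by (intro prod.cong refl insert.prems(2)) (use that in auto)
  have IH: "(\<Prod>B\<in>T. \<Sum>e\<in>B \<rightarrow>\<^sub>E X. g B e) = (\<Sum>e\<in>\<Union>T \<rightarrow>\<^sub>E X. ?h e)"
  proof (rule insert.IH)
    show "disjoint T"
      using insert.prems(1) by (simp add: disjoint_def)
    show "g B' e = g B' e'" if "B' \<in> T" "\<And>i. i \<in> B' \<Longrightarrow> e i = e' i" for B' e e'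
      by (rule insert.prems(2)) (use that in auto)
  qed
  have "(\<Prod>B\<in>insert B T. \<Sum>e\<in>B \<rightarrow>\<^sub>E X. g B e) =
      (\<Sum>e\<in>B \<rightarrow>\<^sub>E X. g B e) * (\<Sum>e\<in>\<Union>T \<rightarrow>\<^sub>E X. ?h e)"
    unfolding prod.insert[OF insert.hyps] IH ..
  also have "\<dots> = (\<Sum>(e1, e2)\<in>(B \<rightarrow>\<^sub>E X) \<times> (\<Union>T \<rightarrow>\<^sub>E X). g B e1 * ?h e2)"
    by (simp add: sum_product sum.cartesian_product)
  also have "\<dots> = (\<Sum>e\<in>\<Union>(insert B T) \<rightarrow>\<^sub>E X. g B e * ?h e)"
  proof (rule sum.reindex_bij_witness)
    let ?i = "\<lambda>e. (restrict e B, restrict e (\<Union>T))"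
    let ?j = "\<lambda>(e1, e2). \<lambda>x. if x \<in> B then e1 x else e2 x"
    fix e12 assume e12: "e12 \<in> (B \<rightarrow>\<^sub>E X) \<times> (\<Union>T \<rightarrow>\<^sub>E X)"
    then obtain e1 e2 where e: "e12 = (e1, e2)" "e1 \<in> B \<rightarrow>\<^sub>E X" "e2 \<in> \<Union>T \<rightarrow>\<^sub>E X"
      by auto
    have e2: "?j e12 i = e2 i" if "i \<in> \<Union>T" for i
      using that disj by (auto simp: e(1))
    show "?i (?j e12) = e12"
      using e e2 by (auto simp: fun_eq_iff restrict_def PiE_def extensional_def)
    show "?j e12 \<in> \<Union>(insert B T) \<rightarrow>\<^sub>E X"
      using e by (auto simp: PiE_iff extensional_def)
    have "g B (?j e12) = g B e1"
      by (rule insert.prems(2)) (simp_all add: e(1))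
    moreover have "?h (?j e12) = ?h e2"
      using e2 by (rule h_local)
    ultimately show "g B (?j e12) * ?h (?j e12) = (case e12 of (e1, e2) \<Rightarrow> g B e1 * ?h e2)"
      by (simp add: e(1))
  next
    fix e assume "e \<in> \<Union>(insert B T) \<rightarrow>\<^sub>E X"
    then show "(\<lambda>(e1, e2). \<lambda>x. if x \<in> B then e1 x else e2 x) (restrict e B, restrict e (\<Union>T)) = e"
      "(restrict e B, restrict e (\<Union>T)) \<in> (B \<rightarrow>\<^sub>E X) \<times> (\<Union>T \<rightarrow>\<^sub>E X)"
      by (auto simp: fun_eq_iff PiE_iff extensional_def)
  qed
  also have "\<dots> = (\<Sum>e\<in>\<Union>(insert B T) \<rightarrow>\<^sub>E X. \<Prod>B\<in>insert B T. g B e)"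
    using insert.hyps by simp
  finally show ?case .
qed simp

section \<open>Injective exponent functions and the set \<open>R_set\<close>\<close>

context alternating_coefficients
begin

text \<open>There are \<open>n div k\<close> blocks, each with sum \<open>k div 2 * (n - 1)\<close>.
  Doubling the total avoids a division and fits \<open>initial_segment_if_sum\<close>.\<close>

lemma sum_values_if_block_sums:
  assumes "block_listing ls" "\<forall>l\<in>set ls. sum_list (map e l) = k div 2 * (n - 1)"
  shows "2 * (\<Sum>i\<in>{1..n}. e i) = n * (n - 1)"
proof -
  have "(\<Sum>i\<in>{1..n}. e i) = sum_list (map e (concat ls))"
    using assms(1) sum_list_distinct_conv_sum_set[of "concat ls" e] by (simp add: block_listing_def)
  also have "\<dots> = (\<Sum>l\<leftarrow>ls. sum_list (map e l))"
    by (simp add: map_concat sum_list_concat comp_def)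
  also have "\<dots> = length ls * (k div 2 * (n - 1))"
    using assms(2) by (simp add: sum_list_triv cong: map_cong)
  also have "2 * \<dots> = (k * length ls) * (n - 1)"
    using k(1) by (auto elim!: evenE simp: mult_ac)
  finally show ?thesis
    by (simp only: block_listing_length[OF assms(1)])
qed

lemma partition_weight_eq_0:
  assumes "\<tau> \<in> block_partitions n k" "B \<in> \<tau>" "(\<Sum>i\<in>B. e i) \<noteq> k div 2 * (n - 1)"
  shows "partition_weight e \<tau> = 0"
proof -
  have fin: "finite \<tau>" "card B = k"
    using assms(1,2) finite_elements[of "{1..n}" \<tau>] by (auto simp: block_partitions_def)
  have "finite B"
    using fin(2) k(2) by (simp add: card_ge_0_finite)
  then have "a (map e (sorted_list_of_set B)) = 0"
    using assms(3) fin by (intro degree) (simp_all add: sum_list_distinct_conv_sum_set)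
  then have "(\<Prod>B\<in>\<tau>. a (map e (sorted_list_of_set B))) = 0"
    using assms(2) fin(1) by (metis (mono_tags, lifting) prod_zero)
  then show ?thesis
    by (simp add: partition_weight_def)
qed

lemma partition_weight_inj_not_bij:
  assumes "\<tau> \<in> block_partitions n k" "inj_on e {1..n}" "\<not> bij_betw e {1..n} {..<n}"
  shows "partition_weight e \<tau> = 0"
proof (rule ccontr)
  assume nonzero: "partition_weight e \<tau> \<noteq> 0"
  let ?ls = "map sorted_list_of_set (enumeration \<tau>)"
  note canon = canonical_listing[OF assms(1)]
  have "sum_list (map e l) = k div 2 * (n - 1)" if "l \<in> set ?ls" for l
  proof -
    have "set l \<in> \<tau>" "distinct l"
      using that canon(1,2) by (auto simp: block_listing_def distinct_concat_iff)
    then show ?thesis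
      using nonzero partition_weight_eq_0[OF assms(1)] by (metis sum_list_distinct_conv_sum_set)
  qed
  then have "2 * (\<Sum>i\<in>{1..n}. e i) = n * (n - 1)"
    using sum_values_if_block_sums[OF canon(1)] by blast
  then have "e ` {1..n} = {..<n}"
    using assms(2) by (intro initial_segment_if_sum) (simp_all add: sum.reindex card_image)
  then show False
    using assms(2,3) by (simp add: bij_betw_def)
qed

text \<open>The entries are distinct and \<open>Gamma_set\<close> prescribes their sum, so they fill
  an initial segment. Hence \<open>vectors_sign\<close> is the sign of a genuine
  permutation.\<close>

lemma R_set_listing:
  assumes "\<beta> \<in> R_set n k"
  defines "rs \<equiv> enumeration \<beta>"
  shows "set rs = \<beta>" "distinct rs" "distinct (concat rs)" "set (concat rs) = {..<n}"
    "vectors_sign \<beta> = list_sign (concat rs)"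
proof -
  have \<beta>: "\<beta> \<subseteq> Gamma_set n k" "card \<beta> = n div k" "inj_on (\<lambda>(r, i). r ! i) (\<beta> \<times> {..<k})"
    using assms(1) by (auto simp: R_set_def)
  \<comment> \<open>Infinite sets have \<open>card\<close> 0, so positivity of the cardinality
    yields finiteness.\<close>
  have "n div k > 0"
    using n k(2) by (metis dvd_imp_le div_greater_zero_iff)
  then have "finite \<beta>"
    using \<beta>(2) card_gt_0_iff by metis
  then show rs: "set rs = \<beta>" "distinct rs"
    by (simp_all add: rs_def enumeration)
  have len: "length r = k" "distinct r" "sum_list r = k div 2 * (n - 1)" if "r \<in> \<beta>" for r
    using that \<beta>(1) by (auto simp: Gamma_set_def strict_sorted_iff)
  show dist: "distinct (concat rs)"
  proof (rule distinct_concat)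
    fix r r' assume r: "r \<in> set rs" "r' \<in> set rs" "r \<noteq> r'"
    show "set r \<inter> set r' = {}"
    proof (rule ccontr)
      assume "set r \<inter> set r' \<noteq> {}"
      then obtain i j where "i < k" "j < k" "r ! i = r' ! j"
        using r rs(1) len(1) by (metis disjoint_iff in_set_conv_nth)
      then have "(r, i) = (r', j)"
        using r rs(1) by (intro inj_onD[OF \<beta>(3)]) auto
      then show False
        using r(3) by simp
    qed
  qed (use rs len in auto)
  have "length rs = n div k"
    using rs \<beta>(2) distinct_card by metis
  then have length_rs: "k * length rs = n"
    using n(1) by simp
  have "card (set (concat rs)) = (\<Sum>r\<leftarrow>rs. length r)"
    using distinct_card[OF dist] by (simp only: length_concat)
  also have "\<dots> = (\<Sum>r\<leftarrow>rs. k)"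
    using rs(1) len(1) by (intro arg_cong[of _ _ sum_list] map_cong) auto
  finally have card: "card (set (concat rs)) = n"
    using length_rs by (simp add: sum_list_triv mult.commute)
  have "\<Sum>(set (concat rs)) = (\<Sum>r\<leftarrow>rs. sum_list r)"
    using sum_list_distinct_conv_sum_set[OF dist, of id] by (simp only: id_def list.map_ident sum_list_concat)
  also have "\<dots> = (\<Sum>r\<leftarrow>rs. k div 2 * (n - 1))"
    using rs(1) len(3) by (intro arg_cong[of _ _ sum_list] map_cong) auto
  also have "2 * \<dots> = (k * length rs) * (n - 1)"
    using k(1) by (auto elim!: evenE simp: mult_ac sum_list_triv)
  finally show set_rs: "set (concat rs) = {..<n}"
    using card length_rs by (intro initial_segment_if_sum) simp_all
  have "length (concat rs) = n"
    using card distinct_card[OF dist] by simp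
  then show "vectors_sign \<beta> = list_sign (concat rs)"
    unfolding vectors_sign_def rs_def[symmetric]
    using dist set_rs by (intro one_line_sign_eq_list_sign) (auto simp: lessThan_atLeast0)
qed

text \<open>Applying \<open>e\<close> entrywise turns a listing of a partition into a listing of the
  corresponding vectors. By \<open>list_sign_map\<close> the two signs differ by the sign of
  \<open>e\<close>, which is the same for all partitions and can be factored out.\<close>

lemma sum_partition_weight_bij:
  assumes e: "bij_betw e {1..n} {..<n}"
  shows "(\<Sum>\<tau>\<in>block_partitions n k. partition_weight e \<tau>) =
    of_int (list_sign (map e [1..<1 + n])) *
      (\<Sum>\<beta>\<in>R_set n k. of_int (vectors_sign \<beta>) * (\<Prod>r\<in>\<beta>. a r))"
proof -
  define d where "d = k div 2 * (n - 1)"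
  define g where "g = inv_into {1..n} e"
  define P where "P = {\<tau> \<in> block_partitions n k. \<forall>B\<in>\<tau>. (\<Sum>i\<in>B. e i) = d}"
  define \<phi> where "\<phi> \<tau> = (\<lambda>B. sorted_list_of_set (e ` B)) ` \<tau>" for \<tau>
  define \<psi> where "\<psi> \<beta> = (\<lambda>r. g ` set r) ` \<beta>" for \<beta>
  let ?s = "list_sign (map e [1..<1 + n])"
  have inj: "inj_on e {1..n}" and image: "e ` {1..n} = {..<n}"
    using e by (auto simp: bij_betw_def)
  have g: "bij_betw g {..<n} {1..n}"
    unfolding g_def using e by (rule bij_betw_inv_into)
  have eg: "e (g i) = i" if "i < n" for i
    unfolding g_def using that image by (intro f_inv_into_f) auto
  have ge: "g (e i) = i" if "i \<in> {1..n}" for i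
    unfolding g_def using inj that by (rule inv_into_f_f)
  \<comment> \<open>A block with the wrong exponent sum would leave \<open>Gamma_set\<close>;
    partitions with such a block have weight 0.\<close>
  have "(\<Sum>\<tau>\<in>block_partitions n k. partition_weight e \<tau>) = (\<Sum>\<tau>\<in>P. partition_weight e \<tau>)"
    using partition_weight_eq_0
    by (intro sum.mono_neutral_right finite_block_partitions) (auto simp: P_def d_def)
  also have "\<dots> = (\<Sum>\<beta>\<in>R_set n k. of_int ?s * (of_int (vectors_sign \<beta>) * (\<Prod>r\<in>\<beta>. a r)))"
  proof (rule sum.reindex_bij_witness[symmetric])
    fix \<beta> assume \<beta>: "\<beta> \<in> R_set n k"
    define rs where "rs = enumeration \<beta>"
    \<comment> \<open>The blocks keep the order of the vectors and are in general not increasing; in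
      this way \<open>e\<close> carries the listing back to \<open>rs\<close> exactly.\<close>
    define ls where "ls = map (map g) rs"
    note rs = R_set_listing[OF \<beta>, folded rs_def]
    have r: "length r = k" "sorted_wrt (<) r" "sum_list r = d" "set r \<subseteq> {..<n}" if "r \<in> \<beta>" for r
      using that \<beta> rs(1,4) by (auto simp: R_set_def Gamma_set_def d_def)
    have concat_ls: "concat ls = map g (concat rs)"
      by (simp add: ls_def map_concat)
    have "distinct (concat ls)" "set (concat ls) = {1..n}"
      unfolding concat_ls distinct_map set_map rs(4) using rs(3) g by (auto simp: bij_betw_def)
    then have listing: "block_listing ls"
      using rs(1) r(1) by (auto simp: block_listing_def ls_def)
    have \<psi>_ls: "\<psi> \<beta> = set ` set ls"
      by (auto simp: \<psi>_def ls_def rs(1) image_image)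
    have inj_g: "inj_on g (set r)" if "r \<in> \<beta>" for r
      using g r(4)[OF that] by (meson bij_betw_def inj_on_subset)
    have eg_set: "(\<lambda>i. e (g i)) ` set r = set r" if "r \<in> \<beta>" for r
      using r(4)[OF that] eg by force
    have eg_list: "map (\<lambda>i. e (g i)) r = r" if "r \<in> \<beta>" for r
      using r(4)[OF that] eg by (intro map_idI) auto
    have "(\<Sum>i\<in>g ` set r. e i) = d" if "r \<in> \<beta>" for r
    proof -
      have "(\<Sum>i\<in>g ` set r. e i) = sum_list (map (\<lambda>i. e (g i)) r)"
        using inj_g[OF that] r(2)[OF that]
        by (simp add: sum.reindex strict_sorted_iff sum_list_distinct_conv_sum_set)
      then show ?thesis
        using eg_list[OF that] r(3)[OF that] by simp
    qed
    then show "\<psi> \<beta> \<in> P"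
      using block_listing_partition[OF listing] by (auto simp: P_def \<psi>_ls[symmetric]) (auto simp: \<psi>_def)
    have "sorted_list_of_set (set r) = r" if "r \<in> \<beta>" for r
      using r(2)[OF that] by (simp add: sorted_list_of_set.idem_if_sorted_distinct strict_sorted_iff)
    then show "\<phi> (\<psi> \<beta>) = \<beta>"
      using eg_set by (simp add: \<phi>_def \<psi>_def image_image cong: image_cong)
    have "map e (concat ls) = concat rs"
      unfolding concat_ls map_map using rs(4) eg by (intro map_idI) auto
    moreover have "length (concat ls) = n"
      using listing distinct_card[of "concat ls"] by (simp add: block_listing_def)
    then have "list_sign (map e (concat ls)) = list_sign (concat ls) * ?s"
      using list_sign_map[of "concat ls" 1 e] listing
      by (simp add: block_listing_def atLeastLessThanSuc_atLeastAtMost del: upt_Suc set_concat)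
    ultimately have "vectors_sign \<beta> = list_sign (concat ls) * ?s"
      by (simp only: rs(5))
    \<comment> \<open>Being its own inverse, the sign of \<open>e\<close> can be moved to the other
      side of the equation.\<close>
    moreover have "?s * ?s = 1"
      using inj by (intro list_sign_square) (simp add: distinct_map atLeastLessThanSuc_atLeastAtMost del: upt_Suc)
    ultimately have sign: "list_sign (concat ls) = ?s * vectors_sign \<beta>"
      by (metis mult.assoc mult.commute mult.right_neutral)
    have "(\<Prod>l\<leftarrow>ls. a (map e l)) = (\<Prod>r\<leftarrow>rs. a r)"
      unfolding ls_def map_map using eg_list rs(1)
      by (intro arg_cong[of _ _ prod_list] map_cong) (auto simp: comp_def)
    also have "\<dots> = (\<Prod>r\<in>\<beta>. a r)"
      using prod.distinct_set_conv_list[OF rs(2), of a] rs(1) by simp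
    finally show "partition_weight e (\<psi> \<beta>) =
        of_int ?s * (of_int (vectors_sign \<beta>) * (\<Prod>r\<in>\<beta>. a r))"
      unfolding \<psi>_ls partition_weight_eq_listing_weight[OF listing] listing_weight_def sign
      by (simp only: of_int_mult mult.assoc)
  next
    fix \<tau> assume \<tau>: "\<tau> \<in> P"
    then have part: "partition_on {1..n} \<tau>" "\<tau> \<in> block_partitions n k"
      and B: "\<And>B. B \<in> \<tau> \<Longrightarrow> card B = k" "\<And>B. B \<in> \<tau> \<Longrightarrow> (\<Sum>i\<in>B. e i) = d"
      by (auto simp: P_def block_partitions_def)
    have sub: "B \<subseteq> {1..n}" "finite B" if "B \<in> \<tau>" for B
      using part(1) that finite_subset[of B "{1..n}"] by (auto simp: partition_on_def)
    have "g ` e ` B = B" if "B \<in> \<tau>" for B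
      using sub(1)[OF that] ge by force
    then show "\<psi> (\<phi> \<tau>) = \<tau>"
      using sub(2) by (simp add: \<phi>_def \<psi>_def image_image cong: image_cong)
    have inj_B: "inj_on e B" if "B \<in> \<tau>" for B
      using inj sub(1)[OF that] by (rule inj_on_subset)
    have nth_in: "sorted_list_of_set (e ` B) ! i \<in> e ` B" if "B \<in> \<tau>" "i < k" for B i
      using that inj_B B(1) sub(2)
      by (metis card_image finite_imageI length_sorted_list_of_set nth_mem set_sorted_list_of_set)
    have same_block: "B = B'" if "B \<in> \<tau>" "B' \<in> \<tau>" "e ` B \<inter> e ` B' \<noteq> {}" for B B'
    proof -
      have "B \<inter> B' \<noteq> {}"
        using that sub(1) inj by (metis image_empty inj_on_image_Int)
      then show ?thesis
        using partition_onD2[OF part(1)] that(1,2) unfolding disjoint_def by blast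
    qed
    have "inj_on (\<lambda>B. sorted_list_of_set (e ` B)) \<tau>"
    proof (rule inj_onI)
      fix B B' assume BB': "B \<in> \<tau>" "B' \<in> \<tau>" "sorted_list_of_set (e ` B) = sorted_list_of_set (e ` B')"
      then have "e ` B = e ` B'"
        using sub(2) by (metis finite_imageI set_sorted_list_of_set)
      moreover have "e ` B \<noteq> {}"
        using BB'(1) part(1) by (auto simp: partition_on_def)
      ultimately show "B = B'"
        using same_block BB'(1,2) by auto
    qed
    then have "card (\<phi> \<tau>) = card \<tau>"
      by (simp add: \<phi>_def card_image)
    also have "\<dots> = n div k"
      using canonical_listing(4)[OF part(2)] k(2) by auto
    finally have "card (\<phi> \<tau>) = n div k" .
    moreover have "\<phi> \<tau> \<subseteq> Gamma_set n k"
    proof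
      fix r assume "r \<in> \<phi> \<tau>"
      then obtain B where BB: "B \<in> \<tau>" "r = sorted_list_of_set (e ` B)"
        by (auto simp: \<phi>_def)
      have "sum_list r = (\<Sum>i\<in>B. e i)"
        using sum_list_distinct_conv_sum_set[of r id] sum.reindex[OF inj_B[OF BB(1)], of id] sub(2)[OF BB(1)]
        by (simp add: BB(2))
      then show "r \<in> Gamma_set n k"
        using BB B inj_B sub(2) by (simp add: Gamma_set_def card_image d_def)
    qed
    moreover have "inj_on (\<lambda>(r, i). r ! i) (\<phi> \<tau> \<times> {..<k})"
    proof (rule inj_onI, clarify)
      fix r i r' i' assume r: "r \<in> \<phi> \<tau>" "r' \<in> \<phi> \<tau>" "i < k" "i' < k" "r ! i = r' ! i'"
      then obtain B B' where BB': "B \<in> \<tau>" "r = sorted_list_of_set (e ` B)"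
        "B' \<in> \<tau>" "r' = sorted_list_of_set (e ` B')"
        by (auto simp: \<phi>_def)
      have "B = B'"
        using nth_in[OF BB'(1) r(3)] nth_in[OF BB'(3) r(4)] r(5) BB' same_block by auto
      then have "r = r'"
        using BB' by simp
      moreover have "length r = k" "distinct r"
        using BB' B(1) inj_B by (auto simp: card_image)
      ultimately show "r = r' \<and> i = i'"
        using r(3-5) by (simp add: nth_eq_iff_index_eq)
    qed
    ultimately show "\<phi> \<tau> \<in> R_set n k"
      by (simp add: R_set_def)
  qed
  finally show ?thesis
    by (simp only: sum_distrib_left)
qed

text \<open>Distributing the product over the blocks turns one choice of exponents per block into a
  single function on \<open>{1..n}\<close>; swapping the sums then collects all partitions for a
  fixed function. The bound on the values keeps the sums finite.\<close>

theorem hyperpfaffian_alternating: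
  fixes x :: "nat \<Rightarrow> 'r"
  shows "hyperpfaffian n k (\<lambda>S. \<Sum>e\<in>S \<rightarrow>\<^sub>E {..k div 2 * (n - 1)}.
      a (map e (sorted_list_of_set S)) * (\<Prod>i\<in>S. x i ^ e i)) =
    (\<Sum>\<beta>\<in>R_set n k. of_int (vectors_sign \<beta>) * (\<Prod>r\<in>\<beta>. a r)) *
      (\<Prod>j\<in>{1..n}. \<Prod>i\<in>{1..<j}. x j - x i)"
proof -
  define d where "d = k div 2 * (n - 1)"
  define M where "M e = (\<Prod>i\<in>{1..n}. x i ^ e i)" for e
  let ?E = "{e. e \<in> extensional {1..n} \<and> bij_betw e {1..n} {..<n}}"
  let ?R = "\<Sum>\<beta>\<in>R_set n k. of_int (vectors_sign \<beta>) * (\<Prod>r\<in>\<beta>. a r)"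
  let ?W = "\<lambda>e. \<Sum>\<tau>\<in>block_partitions n k. partition_weight e \<tau>"
  have block: "of_int (partition_sign \<tau>) * (\<Prod>B\<in>\<tau>. \<Sum>e\<in>B \<rightarrow>\<^sub>E {..d}.
      a (map e (sorted_list_of_set B)) * (\<Prod>i\<in>B. x i ^ e i)) =
    (\<Sum>e\<in>{1..n} \<rightarrow>\<^sub>E {..d}. partition_weight e \<tau> * M e)"
    if "\<tau> \<in> block_partitions n k" for \<tau>
  proof -
    have part: "partition_on {1..n} \<tau>"
      using that by (simp add: block_partitions_def)
    have fin: "finite \<tau>" "finite B" if "B \<in> \<tau>" for B
      using part that finite_elements[OF _ part] finite_subset[of B "{1..n}"]
      by (auto simp: partition_on_def)
    have "finite \<tau>"
      using finite_elements[OF _ part] by simp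
    have "(\<Prod>B\<in>\<tau>. \<Sum>e\<in>B \<rightarrow>\<^sub>E {..d}. a (map e (sorted_list_of_set B)) * (\<Prod>i\<in>B. x i ^ e i)) =
        (\<Sum>e\<in>\<Union>\<tau> \<rightarrow>\<^sub>E {..d}. \<Prod>B\<in>\<tau>. a (map e (sorted_list_of_set B)) * (\<Prod>i\<in>B. x i ^ e i))"
    proof (rule prod_sum_PiE_Union)
      fix B and e e' :: "nat \<Rightarrow> nat"
      assume "B \<in> \<tau>" and eq: "\<And>i. i \<in> B \<Longrightarrow> e i = e' i"
      then have "map e (sorted_list_of_set B) = map e' (sorted_list_of_set B)"
        using fin by (intro map_cong) auto
      moreover have "(\<Prod>i\<in>B. x i ^ e i) = (\<Prod>i\<in>B. x i ^ e' i)"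
        using eq by (intro prod.cong) auto
      ultimately show "a (map e (sorted_list_of_set B)) * (\<Prod>i\<in>B. x i ^ e i) =
          a (map e' (sorted_list_of_set B)) * (\<Prod>i\<in>B. x i ^ e' i)"
        by (simp only:)
    qed (use \<open>finite \<tau>\<close> partition_onD2[OF part] in auto)
    also have "\<Union>\<tau> = {1..n}"
      using part by (simp add: partition_on_def)
    finally have expand: "(\<Prod>B\<in>\<tau>. \<Sum>e\<in>B \<rightarrow>\<^sub>E {..d}.
          a (map e (sorted_list_of_set B)) * (\<Prod>i\<in>B. x i ^ e i)) =
        (\<Sum>e\<in>{1..n} \<rightarrow>\<^sub>E {..d}. \<Prod>B\<in>\<tau>. a (map e (sorted_list_of_set B)) * (\<Prod>i\<in>B. x i ^ e i))" .
    have "(\<Prod>B\<in>\<tau>. \<Prod>i\<in>B. x i ^ e i) = M e" for e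
    proof -
      have "(\<Prod>i\<in>\<Union>\<tau>. x i ^ e i) = (\<Prod>B\<in>\<tau>. \<Prod>i\<in>B. x i ^ e i)"
        using fin partition_onD2[OF part]
        by (subst prod.Union_disjoint) (auto simp: disjoint_def)
      then show ?thesis
        using part by (simp add: M_def partition_on_def)
    qed
    then show ?thesis
      by (simp add: expand partition_weight_def prod.distrib sum_distrib_left mult.assoc)
  qed
  have "hyperpfaffian n k (\<lambda>S. \<Sum>e\<in>S \<rightarrow>\<^sub>E {..d}.
      a (map e (sorted_list_of_set S)) * (\<Prod>i\<in>S. x i ^ e i)) =
    (\<Sum>\<tau>\<in>block_partitions n k. \<Sum>e\<in>{1..n} \<rightarrow>\<^sub>E {..d}. partition_weight e \<tau> * M e)"
    unfolding hyperpfaffian_def by (rule sum.cong[OF refl block])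
  also have "\<dots> = (\<Sum>e\<in>{1..n} \<rightarrow>\<^sub>E {..d}. ?W e * M e)"
    by (subst sum.swap) (simp add: sum_distrib_right)
  also have "\<dots> = (\<Sum>e\<in>?E. ?W e * M e)"
  proof (rule sum.mono_neutral_right)
    show "finite ({1..n} \<rightarrow>\<^sub>E {..d})"
      by (simp add: finite_PiE)
    \<comment> \<open>As \<open>k div 2\<close> is at least 1, the range \<open>{..d}\<close>
      contains all values below \<open>n\<close>, so every bijection occurs in the sum.\<close>
    have "n - 1 \<le> d"
      using k by (auto elim!: evenE simp: d_def)
    then have "e i \<le> d" if "e \<in> ?E" "i \<in> {1..n}" for e i
    proof -
      have "e i < n"
        using that by (auto simp: bij_betw_def)
      then show ?thesis
        using \<open>n - 1 \<le> d\<close> by linarith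
    qed
    then show "?E \<subseteq> {1..n} \<rightarrow>\<^sub>E {..d}"
      by (auto simp: PiE_iff extensional_def)
    have "?W e = 0" if "e \<in> extensional {1..n}" "\<not> bij_betw e {1..n} {..<n}" for e
    proof (cases "inj_on e {1..n}")
      case True
      then show ?thesis
        using partition_weight_inj_not_bij that by (intro sum.neutral) blast
    next
      case False
      then show ?thesis
        using sum_partition_weight_not_inj by (auto simp: inj_on_def)
    qed
    then show "\<forall>e\<in>({1..n} \<rightarrow>\<^sub>E {..d}) - ?E. ?W e * M e = 0"
      by (auto simp: PiE_def)
  qed
  also have "\<dots> = (\<Sum>e\<in>?E. ?R * (of_int (list_sign (map e [1..<1 + n])) * M e))"
    by (rule sum.cong[OF refl]) (simp only: mem_Collect_eq sum_partition_weight_bij mult_ac)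
  also have "\<dots> = ?R * (\<Prod>j\<in>{1..n}. \<Prod>i\<in>{1..<j}. x j - x i)"
    unfolding vandermonde_bijections M_def by (simp only: sum_distrib_left)
  finally show ?thesis
    unfolding d_def .
qed

end

section \<open>Coefficients of skew-symmetric polynomials\<close>

lemma Const_0: "Const 0 = 0"
  by (simp add: Const_def)

lemma Const_1: "Const 1 = 1"
  by (simp add: Const_def)

lemma Const_add: "Const (c + d) = Const c + Const d"
  by (simp add: Const_def single_add)

lemma Const_uminus: "Const (- c) = - Const c"
  by (simp add: Const_def single_uminus)

lemma Const_mult: "Const (c * d) = Const c * Const d"
  by (simp add: Const_def mult_single)

lemma Const_of_int: "Const (of_int z) = of_int z"
  by (simp add: Const_def)

lemma Const_sum: "Const (\<Sum>x\<in>A. h x) = (\<Sum>x\<in>A. Const (h x))"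
  by (induction A rule: infinite_finite_induct) (simp_all add: Const_0 Const_add)

lemma Const_prod: "Const (\<Prod>x\<in>A. h x) = (\<Prod>x\<in>A. Const (h x))"
  by (induction A rule: infinite_finite_induct) (simp_all add: Const_1 Const_mult)

lemma Var_power: "Var i ^ e = Poly_Mapping.single (Poly_Mapping.single i e) 1"
  by (induction e) (simp_all add: Var_def mult_single flip: single_add)

lemma prod_Var_power:
  "(\<Prod>i\<in>A. Var (\<phi> i) ^ e i) = Poly_Mapping.single (\<Sum>i\<in>A. Poly_Mapping.single (\<phi> i) (e i)) 1"
  by (induction A rule: infinite_finite_induct) (simp_all add: Var_power mult_single)

section \<open>Renaming variables in exponent vectors\<close>

definition rename :: "(nat \<Rightarrow> nat) \<Rightarrow> (nat \<Rightarrow>\<^sub>0 nat) \<Rightarrow> (nat \<Rightarrow>\<^sub>0 nat)" where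
  "rename \<phi> m = (\<Sum>i\<in>Poly_Mapping.keys m. Poly_Mapping.single (\<phi> i) (Poly_Mapping.lookup m i))"

lemma rename_superset:
  assumes "finite A" "Poly_Mapping.keys m \<subseteq> A"
  shows "rename \<phi> m = (\<Sum>i\<in>A. Poly_Mapping.single (\<phi> i) (Poly_Mapping.lookup m i))"
  unfolding rename_def using assms
  by (intro sum.mono_neutral_left) (auto simp: in_keys_iff)

lemma lookup_rename:
  assumes "finite A" "Poly_Mapping.keys m \<subseteq> A"
  shows "Poly_Mapping.lookup (rename \<phi> m) l = (\<Sum>i | i \<in> A \<and> \<phi> i = l. Poly_Mapping.lookup m i)"
  using assms(1)
  by (simp add: rename_superset[OF assms] lookup_sum lookup_single when_def sum.If_cases Int_def
    del: sum.delta)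

lemma subst_Var:
  "subst (\<lambda>i. Var (\<phi> i)) f =
    (\<Sum>m\<in>Poly_Mapping.keys f. Poly_Mapping.single (rename \<phi> m) (Poly_Mapping.lookup f m))"
  by (simp add: subst_def prod_Var_power Const_def mult_single rename_def)

text \<open>A renaming that is not injective can make several monomials equal, and their
  coefficients are then added.\<close>

lemma lookup_subst_Var:
  "Poly_Mapping.lookup (subst (\<lambda>i. Var (\<phi> i)) f) m' =
    (\<Sum>m | m \<in> Poly_Mapping.keys f \<and> rename \<phi> m = m'. Poly_Mapping.lookup f m)"
  by (simp add: subst_Var lookup_sum lookup_single when_def sum.If_cases Int_def)

lemma lookup_rename_transpose:
  "Poly_Mapping.lookup (rename (Transposition.transpose i j) m) l =
    Poly_Mapping.lookup m (Transposition.transpose i j l)"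
proof -
  let ?w = "Transposition.transpose i j"
  \<comment> \<open>With this index added, the preimage of \<open>l\<close> is exactly
    \<open>{?w l}\<close>, whether or not that variable occurs in \<open>m\<close>.\<close>
  let ?A = "insert (?w l) (Poly_Mapping.keys m)"
  have "Poly_Mapping.lookup (rename ?w m) l = (\<Sum>x | x \<in> ?A \<and> ?w x = l. Poly_Mapping.lookup m x)"
    by (rule lookup_rename) auto
  also have "{x. x \<in> ?A \<and> ?w x = l} = {?w l}"
    by (auto simp: transpose_eq_iff)
  finally show ?thesis
    by simp
qed

lemma rename_transpose_involutory:
  "rename (Transposition.transpose i j) (rename (Transposition.transpose i j) m) = m"
  by (rule poly_mapping_eqI) (simp add: lookup_rename_transpose)

lemma lookup_rename_merge:
  assumes "i \<noteq> j"
  shows "Poly_Mapping.lookup (rename (id(i := j)) m) l =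
    (if l = j then Poly_Mapping.lookup m i + Poly_Mapping.lookup m j
     else if l = i then 0 else Poly_Mapping.lookup m l)"
proof -
  let ?A = "{i, j, l} \<union> Poly_Mapping.keys m"
  have "Poly_Mapping.lookup (rename (id(i := j)) m) l =
      (\<Sum>x | x \<in> ?A \<and> (id(i := j)) x = l. Poly_Mapping.lookup m x)"
    by (rule lookup_rename) auto
  also have "{x. x \<in> ?A \<and> (id(i := j)) x = l} = (if l = j then {i, j} else if l = i then {} else {l})"
    using assms by auto
  finally have "Poly_Mapping.lookup (rename (id(i := j)) m) l =
      (\<Sum>x\<in>(if l = j then {i, j} else if l = i then {} else {l}). Poly_Mapping.lookup m x)" .
  then show ?thesis
    using assms by (simp del: fun_upd_apply split del: if_split) simp
qed

lemma lookup_rename_transpose_skew: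
  assumes "skew_symmetric k f" "i \<in> {1..k}" "j \<in> {1..k}" "i \<noteq> j"
  shows "Poly_Mapping.lookup f (rename (Transposition.transpose i j) m) = - Poly_Mapping.lookup f m"
proof -
  let ?w = "Transposition.transpose i j"
  have "?w permutes {1..k}"
    using assms by (intro permutes_swap_id)
  then have "subst (\<lambda>i. Var (?w i)) f = - f"
    using assms by (simp add: skew_symmetric_def sign_swap_id)
  then have "- Poly_Mapping.lookup f m = Poly_Mapping.lookup (subst (\<lambda>i. Var (?w i)) f) m"
    by simp
  also have "\<dots> = (\<Sum>m' | m' \<in> Poly_Mapping.keys f \<and> rename ?w m' = m. Poly_Mapping.lookup f m')"
    by (rule lookup_subst_Var)
  also have "{m'. m' \<in> Poly_Mapping.keys f \<and> rename ?w m' = m} =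
      (if rename ?w m \<in> Poly_Mapping.keys f then {rename ?w m} else {})"
    by (auto simp: rename_transpose_involutory)
  finally show ?thesis
    by (simp add: in_keys_iff split: if_splits)
qed

text \<open>Identifying the two variables collects all monomials that agree with \<open>m\<close>
  elsewhere and have the same sum of exponents at \<open>i\<close> and \<open>j\<close>. Exchanging
  these two exponents pairs them with opposite coefficients. The only fixed one is \<open>m\<close>,
  because two equal exponents are determined by their sum, so the collected coefficient 0 is that of
  \<open>m\<close>.\<close>

lemma lookup_eq_0_if_vanishes_on_diagonals:
  fixes f :: "'a::comm_ring_1 mpoly"
  assumes "skew_symmetric k f" "vanishes_on_diagonals k f"
    and ij: "i \<in> {1..k}" "j \<in> {1..k}" "i \<noteq> j"
    and m: "Poly_Mapping.lookup m i = Poly_Mapping.lookup m j"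
  shows "Poly_Mapping.lookup f m = 0"
proof (rule ccontr)
  assume nonzero: "Poly_Mapping.lookup f m \<noteq> 0"
  let ?w = "Transposition.transpose i j"
  let ?\<phi> = "id(i := j)"
  define X where "X = {m'. m' \<in> Poly_Mapping.keys f \<and> rename ?\<phi> m' = rename ?\<phi> m}"
  note skew = lookup_rename_transpose_skew[OF assms(1) ij]
  have "(Var(i := Var j) :: nat \<Rightarrow> 'a mpoly) = (\<lambda>l. Var (?\<phi> l))"
    by auto
  moreover have "subst (Var(i := Var j)) f = 0"
    using assms(2) ij by (simp add: vanishes_on_diagonals_def)
  ultimately have "subst (\<lambda>l. Var (?\<phi> l)) f = 0"
    by (simp only:)
  then have total: "(\<Sum>m'\<in>X. Poly_Mapping.lookup f m') = 0"
    unfolding X_def lookup_subst_Var[symmetric] by (simp only: lookup_zero)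
  have rename_m: "rename ?w m = m"
    using m by (intro poly_mapping_eqI) (auto simp: lookup_rename_transpose transpose_def)
  have rename_\<phi>: "rename ?\<phi> (rename ?w m') = rename ?\<phi> m'" for m'
    using ij(3) by (intro poly_mapping_eqI)
      (auto simp: lookup_rename_merge lookup_rename_transpose transpose_def)
  have "(\<Sum>m'\<in>X - {m}. Poly_Mapping.lookup f m') = 0"
  proof (rule sum_involution_eq_0)
    fix m' assume m': "m' \<in> X - {m}"
    show "Poly_Mapping.lookup f (rename ?w m') + Poly_Mapping.lookup f m' = 0"
      by (simp add: skew)
    have "rename ?w m' \<noteq> m"
      using m' rename_m by (metis DiffE rename_transpose_involutory singletonI)
    then show "rename ?w m' \<in> X - {m}"
      using m' by (simp add: X_def rename_\<phi> in_keys_iff skew)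
    show "rename ?w (rename ?w m') = m'"
      by (rule rename_transpose_involutory)
    show "rename ?w m' \<noteq> m'"
    proof
      assume "rename ?w m' = m'"
      then have eq: "Poly_Mapping.lookup m' i = Poly_Mapping.lookup m' j"
        by (metis lookup_rename_transpose transpose_apply_first)
      have merge: "Poly_Mapping.lookup (rename ?\<phi> m') l = Poly_Mapping.lookup (rename ?\<phi> m) l" for l
        using m' by (simp add: X_def)
      have "Poly_Mapping.lookup m' j = Poly_Mapping.lookup m j"
        using merge[of j] eq m by (simp add: lookup_rename_merge[OF ij(3)])
      then have "m' = m"
        using merge eq m
        by (intro poly_mapping_eqI) (metis lookup_rename_merge[OF ij(3)])
      then show False
        using m' by simp
    qed
  qed
  moreover have "m \<in> X" "finite X"
    using nonzero by (simp_all add: X_def in_keys_iff)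
  ultimately have "(\<Sum>m'\<in>X. Poly_Mapping.lookup f m') = Poly_Mapping.lookup f m"
    by (simp add: sum.remove)
  with total nonzero show False
    by simp
qed

section \<open>Coefficients indexed by exponent lists\<close>

definition exponent :: "nat list \<Rightarrow> (nat \<Rightarrow>\<^sub>0 nat)" where
  "exponent r = (\<Sum>i = 1..length r. Poly_Mapping.single i (r ! (i - 1)))"

lemma coefficient_eq: "coefficient f r = Poly_Mapping.lookup f (exponent r)"
  by (simp add: coefficient_def exponent_def)

lemma lookup_exponent:
  "Poly_Mapping.lookup (exponent r) i = (if i \<in> {1..length r} then r ! (i - 1) else 0)"
  by (auto simp: exponent_def lookup_sum lookup_single when_def)

lemma keys_exponent: "Poly_Mapping.keys (exponent r) \<subseteq> {1..length r}"
  using lookup_exponent[of r] by (auto simp: in_keys_iff split: if_splits)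

lemma coefficient_eq_0_if_degree:
  assumes "homogeneous d f" "sum_list r \<noteq> d"
  shows "coefficient f r = 0"
proof (rule ccontr)
  assume "coefficient f r \<noteq> 0"
  then have "exponent r \<in> Poly_Mapping.keys f"
    by (simp add: coefficient_eq in_keys_iff)
  then have "d = (\<Sum>i\<in>Poly_Mapping.keys (exponent r). Poly_Mapping.lookup (exponent r) i)"
    using assms(1) by (simp add: homogeneous_def)
  also have "\<dots> = (\<Sum>i\<in>{1..length r}. Poly_Mapping.lookup (exponent r) i)"
    using keys_exponent[of r] by (intro sum.mono_neutral_left) (auto simp: in_keys_iff)
  also have "\<dots> = (\<Sum>i\<in>Suc ` {0..<length r}. r ! (i - 1))"
    by (intro sum.cong) (auto simp: lookup_exponent image_Suc_atLeastLessThan)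
  also have "\<dots> = sum_list r"
    by (simp only: sum.reindex[OF inj_Suc] comp_def diff_Suc_1 sum_list_sum_nth)
  finally show False
    using assms(2) by simp
qed

lemma skew_on_lists_coefficient:
  assumes "skew_symmetric k f"
  shows "skew_on_lists k (coefficient f)"
  unfolding skew_on_lists_def
proof (intro allI impI)
  fix A B C :: "nat list" and x y
  assume len: "length (A @ x # B @ y # C) = k"
  \<comment> \<open>Variables are numbered from 1 and list positions from 0; these are the variables
    with exponents \<open>x\<close> and \<open>y\<close>.\<close>
  let ?i = "Suc (length A)" and ?j = "Suc (Suc (length A + length B))"
  have "exponent (A @ x # B @ y # C) = rename (Transposition.transpose ?i ?j) (exponent (A @ y # B @ x # C))"
    by (rule poly_mapping_eqI)
       (auto simp: lookup_rename_transpose lookup_exponent transpose_def nth_append nth_Cons')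
  then show "coefficient f (A @ x # B @ y # C) = - coefficient f (A @ y # B @ x # C)"
    using len by (simp add: coefficient_eq lookup_rename_transpose_skew[OF assms])
qed

text \<open>The vector \<open>M e\<close> is the one that the substitution turns into the monomial
  with exponents \<open>e\<close>. Every monomial of \<open>f\<close> has this form: it involves
  only the first \<open>k\<close> variables, and each exponent is at most the degree. The remaining
  functions contribute coefficient 0.\<close>

lemma eval_at_subset_expand:
  assumes f: "in_variables {1..k} f" "homogeneous d f" and S: "finite S" "card S = k"
  shows "eval_at_subset f S = (\<Sum>e\<in>S \<rightarrow>\<^sub>E {..d}.
    Const (coefficient f (map e (sorted_list_of_set S))) * (\<Prod>i\<in>S. Var i ^ e i))"
proof -
  define s where "s = sorted_list_of_set S"
  define \<phi> where "\<phi> i = s ! (i - 1)" for i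
  define M where "M e = exponent (map e s)" for e
  define h where "h m = Poly_Mapping.single (rename \<phi> m) (Poly_Mapping.lookup f m)" for m
  have s: "length s = k" "distinct s" "set s = S"
    using S by (simp_all add: s_def)
  have "bij_betw (\<lambda>i. i - 1) {1..k} {..<k}"
    by (rule bij_betw_byWitness[of _ Suc]) auto
  then have \<phi>: "bij_betw \<phi> {1..k} S"
    using bij_betw_trans[of "\<lambda>i. i - 1" _ _ "(!) s"] bij_betw_nth[of s "{..<k}" S] s
    by (simp add: comp_def \<phi>_def[abs_def])
  have lookup_M: "Poly_Mapping.lookup (M e) i = (if i \<in> {1..k} then e (\<phi> i) else 0)" for e i
    by (auto simp: M_def lookup_exponent s(1) \<phi>_def)
  have rename_M: "rename \<phi> (M e) = (\<Sum>x\<in>S. Poly_Mapping.single x (e x))" for e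
  proof -
    have "rename \<phi> (M e) = (\<Sum>i\<in>{1..k}. Poly_Mapping.single (\<phi> i) (Poly_Mapping.lookup (M e) i))"
      using keys_exponent[of "map e s"] s(1) by (intro rename_superset) (auto simp: M_def)
    also have "\<dots> = (\<Sum>i\<in>{1..k}. Poly_Mapping.single (\<phi> i) (e (\<phi> i)))"
      by (intro sum.cong) (auto simp: lookup_M)
    also have "\<dots> = (\<Sum>x\<in>S. Poly_Mapping.single x (e x))"
      using \<phi> by (rule sum.reindex_bij_betw)
    finally show ?thesis .
  qed
  have inj: "inj_on M (S \<rightarrow>\<^sub>E {..d})"
  proof (rule inj_onI)
    fix e e' assume e: "e \<in> S \<rightarrow>\<^sub>E {..d}" "e' \<in> S \<rightarrow>\<^sub>E {..d}" "M e = M e'"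
    show "e = e'"
    proof (rule PiE_ext[OF e(1,2)])
      fix x assume "x \<in> S"
      then obtain i where "i \<in> {1..k}" "x = \<phi> i"
        using \<phi> by (auto simp: bij_betw_def)
      then show "e x = e' x"
        using lookup_M[of e i] lookup_M[of e' i] e(3) by simp
    qed
  qed
  have surj: "Poly_Mapping.keys f \<subseteq> M ` (S \<rightarrow>\<^sub>E {..d})"
  proof
    fix m assume m: "m \<in> Poly_Mapping.keys f"
    \<comment> \<open>The exponent of \<open>x\<close> is read off at the variable that \<phi> sends
      to \<open>x\<close>.\<close>
    define e where "e = restrict (\<lambda>x. Poly_Mapping.lookup m (inv_into {1..k} \<phi> x)) S"
    have keys: "Poly_Mapping.keys m \<subseteq> {1..k}"
      using f(1) m by (auto simp: in_variables_def)
    have "Poly_Mapping.lookup m i \<le> d" for i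
    proof (cases "i \<in> Poly_Mapping.keys m")
      case True
      then have "Poly_Mapping.lookup m i \<le> (\<Sum>i\<in>Poly_Mapping.keys m. Poly_Mapping.lookup m i)"
        by (intro member_le_sum) auto
      then show ?thesis
        using f(2) m by (simp add: homogeneous_def)
    qed (simp add: in_keys_iff)
    then have "e \<in> S \<rightarrow>\<^sub>E {..d}"
      by (auto simp: e_def)
    moreover have "M e = m"
    proof (rule poly_mapping_eqI)
      fix i
      show "Poly_Mapping.lookup (M e) i = Poly_Mapping.lookup m i"
      proof (cases "i \<in> {1..k}")
        case True
        then have "\<phi> i \<in> S" "inv_into {1..k} \<phi> (\<phi> i) = i"
          using \<phi> by (auto simp: bij_betw_def)
        then show ?thesis
          using True by (simp add: lookup_M e_def)
      next
        case False
        then have "Poly_Mapping.lookup m i = 0"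
          using keys by (meson in_keys_iff subsetD)
        with False show ?thesis
          by (auto simp: lookup_M)
      qed
    qed
    ultimately show "m \<in> M ` (S \<rightarrow>\<^sub>E {..d})"
      by blast
  qed
  have "eval_at_subset f S = (\<Sum>m\<in>Poly_Mapping.keys f. h m)"
    by (simp add: eval_at_subset_def subst_Var h_def \<phi>_def[abs_def] s_def)
  also have "\<dots> = (\<Sum>m\<in>M ` (S \<rightarrow>\<^sub>E {..d}). h m)"
    using surj S(1) by (intro sum.mono_neutral_left) (auto simp: h_def in_keys_iff intro: finite_PiE)
  also have "\<dots> = (\<Sum>e\<in>S \<rightarrow>\<^sub>E {..d}. h (M e))"
    using inj by (simp add: sum.reindex)
  also have "\<dots> = (\<Sum>e\<in>S \<rightarrow>\<^sub>E {..d}. Const (coefficient f (map e s)) * (\<Prod>i\<in>S. Var i ^ e i))"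
    by (intro sum.cong refl)
       (simp add: h_def rename_M M_def[symmetric] coefficient_eq Const_def prod_Var_power[of "\<lambda>i. i"] mult_single)
  finally show ?thesis
    by (simp only: s_def)
qed

lemma coefficient_eq_0_if_repeated:
  fixes f :: "'a::comm_ring_1 mpoly"
  assumes n: "even k" "k dvd n" "n > 0"
    and f: "homogeneous (k div 2 * (n - 1)) f" "skew_symmetric k f"
    and diagonals: "k = 2 \<or> (\<forall>c::'a. 2 * c = 0 \<longrightarrow> c = 0) \<or> vanishes_on_diagonals k f"
    and r: "length r = k" "\<not> distinct r"
  shows "coefficient f r = 0"
proof -
  obtain p q where pq: "p < k" "q < k" "p \<noteq> q" "r ! p = r ! q"
    using r by (auto simp: distinct_conv_nth)
  let ?i = "Suc p" and ?j = "Suc q"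
  have ij: "?i \<in> {1..k}" "?j \<in> {1..k}" "?i \<noteq> ?j"
    using pq by auto
  have lookup: "Poly_Mapping.lookup (exponent r) ?i = Poly_Mapping.lookup (exponent r) ?j"
    using pq r(1) by (simp add: lookup_exponent)
  from diagonals show ?thesis
  proof (elim disjE)
    \<comment> \<open>The degree is \<open>n - 1\<close>, which is odd as 2 divides
      \<open>n\<close>, while two equal exponents have an even sum.\<close>
    assume "k = 2"
    then obtain s where s: "r = [s, s]"
      using r by (auto simp: length_Suc_conv numeral_2_eq_2)
    have "even n"
      using n(1,2) by (meson dvd_trans)
    then have "odd (n - 1)"
      using n(3) by simp
    moreover have "even (sum_list r)"
      by (simp add: s)
    ultimately have "sum_list r \<noteq> n - 1"
      by metis
    then show ?thesis
      using f(1) \<open>k = 2\<close> by (intro coefficient_eq_0_if_degree) auto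
  next
    assume no_2_torsion: "\<forall>c::'a. 2 * c = 0 \<longrightarrow> c = 0"
    \<comment> \<open>Exchanging equal exponents fixes the exponent vector, so the coefficient
      equals its own negative.\<close>
    have "rename (Transposition.transpose ?i ?j) (exponent r) = exponent r"
      using lookup by (intro poly_mapping_eqI) (auto simp: lookup_rename_transpose transpose_def)
    then have "coefficient f r = - coefficient f r"
      using lookup_rename_transpose_skew[OF f(2) ij, of "exponent r"] by (simp add: coefficient_eq)
    then have "2 * coefficient f r = 0"
      by (metis add.right_inverse mult_2)
    with no_2_torsion show ?thesis
      by blast
  next
    assume "vanishes_on_diagonals k f"
    then show ?thesis
      unfolding coefficient_eq using f(2) ij lookup by (intro lookup_eq_0_if_vanishes_on_diagonals)
  qed
qed

lemma hyperpfaffian_cong: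
  assumes "\<And>B. finite B \<Longrightarrow> card B = k \<Longrightarrow> F B = G B"
  shows "hyperpfaffian n k F = hyperpfaffian n k G"
  unfolding hyperpfaffian_def
proof (intro sum.cong arg_cong2[of _ _ _ _ "(*)"] prod.cong refl)
  fix \<tau> B assume "\<tau> \<in> block_partitions n k" "B \<in> \<tau>"
  then have "B \<subseteq> {1..n}" "card B = k"
    by (auto simp: block_partitions_def partition_on_def)
  then show "F B = G B"
    by (intro assms) (auto intro: finite_subset)
qed

theorem theorem4p1:
  fixes n k :: nat and f :: "'a::comm_ring_1 mpoly"
  assumes "even k" and "k > 0"
    and "k dvd n" and "n > 0"
    and "in_variables {1..k} f"
    and "homogeneous (k div 2 * (n - 1)) f"
    and "skew_symmetric k f"
    and "k = 2 \<or> (\<forall>c::'a. 2 * c = 0 \<longrightarrow> c = 0) \<or> vanishes_on_diagonals k f"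
  shows "hyperpfaffian n k (eval_at_subset f) =
    Const (\<Sum>\<beta>\<in>R_set n k. of_int (vectors_sign \<beta>) * (\<Prod>r\<in>\<beta>. coefficient f r))
    * (\<Prod>j\<in>{1..n}. \<Prod>i\<in>{1..<j}. (Var j - Var i))"
proof -
  \<comment> \<open>Embedding the coefficients as constants puts them into the ring of the
    indeterminates, so that \<open>x i\<close> can be taken to be \<open>Var i\<close>.\<close>
  define a :: "nat list \<Rightarrow> 'a mpoly" where "a r = Const (coefficient f r)" for r
  interpret alternating_coefficients n k a
  proof
    show "skew_on_lists k a"
      using skew_on_lists_coefficient[OF assms(7)]
      unfolding skew_on_lists_def a_def by (metis Const_uminus)
    show "a r = 0" if "length r = k" "\<not> distinct r" for r
      using coefficient_eq_0_if_repeated[OF assms(1,3,4,6,7,8) that] by (simp add: a_def Const_0)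
    show "a r = 0" if "length r = k" "sum_list r \<noteq> k div 2 * (n - 1)" for r
      using coefficient_eq_0_if_degree[OF assms(6) that(2)] by (simp add: a_def Const_0)
  qed (use assms in auto)
  have "hyperpfaffian n k (eval_at_subset f) =
      hyperpfaffian n k (\<lambda>S. \<Sum>e\<in>S \<rightarrow>\<^sub>E {..k div 2 * (n - 1)}.
        a (map e (sorted_list_of_set S)) * (\<Prod>i\<in>S. Var i ^ e i))"
    unfolding a_def using assms(5,6) by (intro hyperpfaffian_cong eval_at_subset_expand)
  also have "\<dots> = (\<Sum>\<beta>\<in>R_set n k. of_int (vectors_sign \<beta>) * (\<Prod>r\<in>\<beta>. a r)) *
      (\<Prod>j\<in>{1..n}. \<Prod>i\<in>{1..<j}. Var j - Var i)"
    by (rule hyperpfaffian_alternating)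
  also have "(\<Sum>\<beta>\<in>R_set n k. of_int (vectors_sign \<beta>) * (\<Prod>r\<in>\<beta>. a r)) =
      Const (\<Sum>\<beta>\<in>R_set n k. of_int (vectors_sign \<beta>) * (\<Prod>r\<in>\<beta>. coefficient f r))"
    by (simp add: a_def Const_sum Const_mult Const_prod Const_of_int)
  finally show ?thesis .
qed

end
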